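(* Let $\ell\in\tfrac12\mathbb Z_{\ge0}$, $i\in\{1,2\}$, and let $\chi(z)=\sum_{k=0}^\infty\chi_{-\frac k2}z^{\frac k2-1}\in\mathbb C((z^{1/2}))$ with $\chi_0=\ell+\tfrac12$. Then the $\mathcal A^{tw}$-module $F^{T_i}(\chi)$ is irreducible if and only if $$S_{2\ell}(-2\chi^{(1)}_{-1},-2\chi^{(1)}_{-2},\dots)\ne0,$$ where $S_{2\ell}$ is the Schur polynomial and $\chi^{(1)}(z)=\sum_{n\in\mathbb Z}\chi^{(1)}_nz^{-n-1}$ is the integral part of $\chi(z)$ (so $\chi^{(1)}_{-n}=\chi_{-n}$ for $n\in\mathbb Z_{\ge0}$).
   Context: **Schur polynomials.** $S_r(x_1,x_2,\dots)$, $r\ge0$, are defined by $\exp\big(\sum_{n\ge1}\frac{x_n}{n}y^n\big)=\sum_{r\ge0}S_r(x_1,x_2,\dots)y^r$. **The Lie superalgebra $\mathcal A^{tw}$.** It has basis $\mathcal S(n),\mathcal T(n+\tfrac12),\mathcal G(r),C$ ($n\in\mathbb Z$, $r\in\tfrac12\mathbb Z$), with $\mathcal S(n),\mathcal T(n+\frac12),C$ even and central, $\mathcal G(r)$ odd, and $$\{\mathcal G(r),\mathcal G(s)\}=(-1)^{2r+1}\Big(2\delta^{\mathbb Z}_{r+s}\mathcal S(r+s)-\delta^{\frac12+\mathbb Z}_{r+s}(r-s)\mathcal T(r+s)+\tfrac C3\delta^{\mathbb Z}_{r+s}(r^2-\tfrac14)\delta_{r+s,0}\Big),$$ where $\delta_m^X=1$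 if $m\in X$, $0$ otherwise. **The modules $F^{T_i}(\chi)$.** Let $CL^{tw}$ be the associative algebra generated by $\Phi(r)$, $r\in\tfrac12\mathbb Z$, with $\{\Phi(r),\Phi(s)\}=-(-1)^{2r}\delta_{r+s,0}$. For $i=1,2$ let $F^{T_i}$ be the irreducible $CL^{tw}$-module generated by a vector $\mathbf 1$ with $\Phi(r)\mathbf 1=0$ for $r>0$ and $\Phi(0)\mathbf 1=(-1)^i\frac1{\sqrt{-2}}\mathbf 1$; as a vector space $F^{T_i}=\bigwedge(\Phi(r)\mid r\in\frac12\mathbb Z,\ r<0)$. Put $\Phi(z)=\sum_{r\in\frac12\mathbb Z}\Phi(r)z^{-r-1/2}$. For $\chi(z)=\sum_{n\in\frac12\mathbb Z}\chi_nz^{-n-1}\in\mathbb C((z^{1/2}))$, $F^{T_i}(\chi)$ is the space $F^{T_i}$ with the $\mathcal A^{tw}$-action (with $C=-3$, and $\mathcal S(n),\mathcal T(n+\frac12)$ acting by scalars) given by $$\sum_{r\in\frac12\mathbb Z}\mathcal G(r)z^{-r-3/2}=\partial_z\Phi(z)+\chi(z)\Phi(z),\quad\text{i.e. } \mathcal G(r)=-(r+\tfrac12)\Phi(r)+\sum_{k\in\frac12\mathbb Z}\chi_k\Phi(r-k).$$ Irreducible means no proper nonzero invariant subspace (modules need not be $\mathbb Z_2$-graded). *)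

theory Defs
  imports Complex_Main
    "HOL-Computational_Algebra.Computational_Algebra"
    "HOL-Library.Poly_Mapping"
    "HOL-Library.FSet"
begin

text \<open>
  Half-integer indices are doubled throughout: the integer \<open>m\<close> stands for the index \<open>m/2\<close>.
  So \<open>Phi m\<close> is \<open>\<Phi>(m/2)\<close>, \<open>G m\<close> is \<open>\<G>(m/2)\<close>, and the parity of \<open>m\<close> decides whether
  \<open>m/2\<close> lies in \<open>\<int>\<close> or in \<open>1/2 + \<int>\<close>.
\<close>

section \<open>Laurent series in the square root of z, and Schur polynomials\<close>

text \<open>
  A series \<open>\<chi>(z)\<close> in \<open>\<complex>((z\<^bsup>1/2\<^esup>))\<close> is a formal Laurent series in the variable \<open>w = z\<^bsup>1/2\<^esup>\<close>.
  In \<open>\<chi>(z) = \<Sum>\<^sub>n \<chi>\<^sub>n z\<^bsup>-n-1\<^esup>\<close> the coefficient with \<open>n = m/2\<close> is that of \<open>w\<^bsup>-m-2\<^esup>\<close>.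
\<close>

definition half_mode :: "complex fls \<Rightarrow> int \<Rightarrow> complex" where
  "half_mode \<chi> m = fls_nth \<chi> (- m - 2)"

text \<open>For \<open>\<psi>(z) = \<Sum>\<^sub>n \<psi>\<^sub>n z\<^bsup>-n-1\<^esup>\<close> in \<open>\<complex>((z))\<close>, the series variable being \<open>z\<close> itself.\<close>

definition int_mode :: "complex fls \<Rightarrow> int \<Rightarrow> complex" where
  "int_mode \<psi> n = fls_nth \<psi> (- n - 1)"

text \<open>The integral part of \<open>\<chi>(z)\<close>: the terms \<open>z\<^bsup>k\<^esup> = w\<^bsup>2k\<^esup>\<close>, as a series in \<open>z\<close>.\<close>

definition integral_part :: "complex fls \<Rightarrow> complex fls" where
  "integral_part \<chi> = Abs_fls (\<lambda>k. fls_nth \<chi> (2 * k))"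

lemma int_mode_integral_part: "int_mode (integral_part \<chi>) n = half_mode \<chi> (2 * n)"
proof -
  obtain N where N: "\<And>k. k < N \<Longrightarrow> fls_nth \<chi> k = 0"
    by (meson fls_eq0_below_subdegree)
  have "fls_nth \<chi> (2 * k) = 0" if "k < min N 0" for k
    using that by (intro N) linarith
  then have "fls_nth (integral_part \<chi>) k = fls_nth \<chi> (2 * k)" for k
    unfolding integral_part_def by (subst nth_Abs_fls_lower_bound[of "min N 0"]) auto
  then show ?thesis by (simp add: int_mode_def half_mode_def algebra_simps)
qed

text \<open>The sequence \<open>x\<close> lists the arguments \<open>x 1, x 2, \<dots>\<close>; the value \<open>x 0\<close> is irrelevant.\<close>

definition schur :: "nat \<Rightarrow> (nat \<Rightarrow> 'a::field_char_0) \<Rightarrow> 'a" where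
  "schur r x =
     fps_nth (fps_compose (fps_exp 1) (Abs_fps (\<lambda>n. if n = 0 then 0 else x n / of_nat n))) r"

section \<open>The Lie superalgebra\<close>

text \<open>
  The basis; \<open>S n\<close> is \<open>\<S>(n)\<close>, \<open>T n\<close> is \<open>\<T>(n + 1/2)\<close> and \<open>G m\<close> is \<open>\<G>(m/2)\<close>.  The superalgebra is
  the free vector space \<open>atw \<Rightarrow>\<^sub>0 complex\<close> on it, and the bracket, given on the basis, is
  extended bilinearly.
\<close>

datatype atw = S int | T int | G int | C

fun odd_atw :: "atw \<Rightarrow> bool" where
  "odd_atw (G m) = True"
| "odd_atw _ = False"

fun atw_bracket :: "atw \<Rightarrow> atw \<Rightarrow> (atw \<Rightarrow>\<^sub>0 complex)" where
  "atw_bracket (G a) (G b) =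
     (let r = of_int a / 2; s = of_int b / 2; sgn = (-1) powi (a + 1) in
        if even (a + b)
        then Poly_Mapping.single (S ((a + b) div 2)) (sgn * 2)
           + Poly_Mapping.single C (if a + b = 0 then sgn * ((r\<^sup>2 - 1/4) / 3) else 0)
        else Poly_Mapping.single (T ((a + b - 1) div 2)) (- sgn * (r - s)))"
| "atw_bracket _ _ = 0"

locale atw_module = vector_space scale
  for scale :: "complex \<Rightarrow> 'v::ab_group_add \<Rightarrow> 'v" +
  fixes \<rho> :: "atw \<Rightarrow> 'v \<Rightarrow> 'v"
  assumes linear_rho: "Vector_Spaces.linear scale scale (\<rho> x)"
    and rho_bracket:
      "\<rho> x (\<rho> y v) - scale (if odd_atw x \<and> odd_atw y then -1 else 1) (\<rho> y (\<rho> x v)) =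
         (\<Sum>b\<in>Poly_Mapping.keys (atw_bracket x y).
            scale (Poly_Mapping.lookup (atw_bracket x y) b) (\<rho> b v))"

section \<open>Irreducibility, for any family of operators\<close>

definition invariant_subspace ::
    "(complex \<Rightarrow> 'v::ab_group_add \<Rightarrow> 'v) \<Rightarrow> ('g \<Rightarrow> 'v \<Rightarrow> 'v) \<Rightarrow> 'v set \<Rightarrow> bool" where
  "invariant_subspace scale \<rho> U \<longleftrightarrow>
     module.subspace scale U \<and> (\<forall>x. \<forall>u\<in>U. \<rho> x u \<in> U)"

definition irreducible_action ::
    "(complex \<Rightarrow> 'v::ab_group_add \<Rightarrow> 'v) \<Rightarrow> ('g \<Rightarrow> 'v \<Rightarrow> 'v) \<Rightarrow> bool" where
  "irreducible_action scale \<rho> \<longleftrightarrow>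
     (\<forall>U. invariant_subspace scale \<rho> U \<longrightarrow> U = {0} \<or> U = UNIV)"

section \<open>The twisted Clifford algebra and its irreducible modules\<close>

locale cltw_module = vector_space scale
  for scale :: "complex \<Rightarrow> 'v::ab_group_add \<Rightarrow> 'v" +
  fixes Phi :: "int \<Rightarrow> 'v \<Rightarrow> 'v"
  assumes linear_Phi: "Vector_Spaces.linear scale scale (Phi a)"
    and anticommutator:
      "Phi a (Phi b v) + Phi b (Phi a v) = scale (if a + b = 0 then - ((-1) powi a) else 0) v"

locale FT_module = cltw_module scale Phi
  for scale :: "complex \<Rightarrow> 'v::ab_group_add \<Rightarrow> 'v" and Phi :: "int \<Rightarrow> 'v \<Rightarrow> 'v" +
  fixes vac :: 'v and i :: nat
  assumes vac_nonzero: "vac \<noteq> 0"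
    and irreducible: "irreducible_action scale Phi"
    and generated: "invariant_subspace scale Phi U \<Longrightarrow> vac \<in> U \<Longrightarrow> U = UNIV"
    and annihilate: "m > 0 \<Longrightarrow> Phi m vac = 0"
    and zero_mode: "Phi 0 vac = scale ((-1) ^ i * (1 / csqrt (-2))) vac"

section \<open>The action on the modules\<close>

text \<open>
  All sums are finite: \<open>half_mode \<chi> k\<close> vanishes for large \<open>k\<close>, and \<open>Phi m v\<close> vanishes for
  large \<open>m\<close> (depending on \<open>v\<close>).

  The scalars by which \<open>S n\<close> and \<open>T n\<close> act are forced by the bracket and by \<open>C = -3\<close>:
  \<open>\<S>(n) = (\<Sum>\<^sub>j (-1)\<^bsup>2j\<^esup> \<chi>\<^sub>j \<chi>\<^bsub>n-j\<^esub> - (n + 1) \<chi>\<^sub>n) / 2\<close>, with \<open>j\<close> running over the half-integers,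
  and \<open>\<T>(n + 1/2) = \<chi>\<^bsub>n+1/2\<^esub>\<close>; see \<open>atw_module_FT_action\<close> below.
\<close>

fun FT_action ::
    "(complex \<Rightarrow> 'v::ab_group_add \<Rightarrow> 'v) \<Rightarrow> (int \<Rightarrow> 'v \<Rightarrow> 'v) \<Rightarrow> complex fls \<Rightarrow> atw \<Rightarrow> 'v \<Rightarrow> 'v" where
  "FT_action scale Phi \<chi> (G m) v =
     scale (- (of_int m / 2 + 1/2)) (Phi m v)
     + Sum_any (\<lambda>k. scale (half_mode \<chi> k) (Phi (m - k) v))"
| "FT_action scale Phi \<chi> (S n) v =
     scale ((Sum_any (\<lambda>j. (-1) powi j * half_mode \<chi> j * half_mode \<chi> (2 * n - j))
             - (of_int n + 1) * half_mode \<chi> (2 * n)) / 2) v"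
| "FT_action scale Phi \<chi> (T n) v = scale (half_mode \<chi> (2 * n + 1)) v"
| "FT_action scale Phi \<chi> C v = scale (-3) v"


section \<open>The action satisfies the relations of the Lie superalgebra\<close>

lemma half_mode_bounded: "\<exists>K. \<forall>k>K. half_mode \<chi> k = 0"
proof (intro exI allI impI)
  fix k :: int
  assume "k > - 2 - fls_subdegree \<chi>"
  then show "half_mode \<chi> k = 0"
    unfolding half_mode_def by (intro fls_eq0_below_subdegree) linarith
qed

lemma odd_convolution_zero:
  fixes h :: "int \<Rightarrow> complex"
  assumes "odd m"
  shows "Sum_any (\<lambda>j. (-1) powi j * h j * h (m - j)) = 0"
proof -
  let ?f = "\<lambda>j. (-1) powi j * h j * h (m - j)"
  have neg: "?f (m - j) = - ?f j" for j
    using assms by (auto simp: power_int_minus_left)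
  have "Sum_any ?f = Sum_any (?f \<circ> (\<lambda>j. m - j))"
    unfolding Sum_any.expand_set
    by (rule sum.reindex_bij_witness[of _ "\<lambda>j. m - j" "\<lambda>j. m - j"]) auto
  also have "\<dots> = Sum_any (\<lambda>j. - ?f j)"
    unfolding comp_def by (simp only: neg)
  also have "\<dots> = - Sum_any ?f"
    unfolding Sum_any.expand_set by (simp add: sum_negf del: mult_minus_left)
  finally show ?thesis by simp
qed

context cltw_module
begin

lemma Phi_add: "Phi a (u + v) = Phi a u + Phi a v"
  and Phi_scale: "Phi a (scale c v) = scale c (Phi a v)"
  and Phi_zero: "Phi a 0 = 0"
  and Phi_sum: "Phi a (\<Sum>x\<in>A. f x) = (\<Sum>x\<in>A. Phi a (f x))"
proof -
  interpret L: Vector_Spaces.linear scale scale "Phi a" by (rule linear_Phi)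
  show "Phi a (u + v) = Phi a u + Phi a v" "Phi a (scale c v) = scale c (Phi a v)"
    "Phi a 0 = 0" "Phi a (\<Sum>x\<in>A. f x) = (\<Sum>x\<in>A. Phi a (f x))"
    by (simp_all add: L.add L.scale L.zero L.sum)
qed

definition G_coeff :: "complex fls \<Rightarrow> int \<Rightarrow> int \<Rightarrow> complex" where
  "G_coeff \<chi> m j = half_mode \<chi> (m - j) - (if j = m then of_int m / 2 + 1/2 else 0)"

lemma G_action_window:
  assumes K: "\<And>k. k > K \<Longrightarrow> half_mode \<chi> k = 0" and R: "\<And>j. j > R \<Longrightarrow> Phi j v = 0"
    and "L \<le> m - K" "L \<le> m" "m \<le> R"
  shows "FT_action scale Phi \<chi> (G m) v = (\<Sum>j\<in>{L..R}. scale (G_coeff \<chi> m j) (Phi j v))"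
proof -
  let ?g = "\<lambda>k. scale (half_mode \<chi> k) (Phi (m - k) v)"
  have "{k. ?g k \<noteq> 0} \<subseteq> {m - R..m - L}"
    using assms by (auto simp: not_less[symmetric])
  then have "Sum_any ?g = (\<Sum>k\<in>{m - R..m - L}. ?g k)"
    by (rule Sum_any.expand_superset[rotated]) simp
  also have "\<dots> = (\<Sum>j\<in>{L..R}. scale (half_mode \<chi> (m - j)) (Phi j v))"
    by (rule sum.reindex_bij_witness[of _ "\<lambda>j. m - j" "\<lambda>j. m - j"]) auto
  finally have 1: "Sum_any ?g = (\<Sum>j\<in>{L..R}. scale (half_mode \<chi> (m - j)) (Phi j v))" .
  have "(\<Sum>j\<in>{L..R}. scale (if j = m then of_int m / 2 + 1/2 else 0) (Phi j v))
      = (\<Sum>j\<in>{L..R}. if j = m then scale (of_int m / 2 + 1/2) (Phi m v) else 0)"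
    by (rule sum.cong) auto
  also have "\<dots> = scale (of_int m / 2 + 1/2) (Phi m v)"
    using assms by simp
  finally show ?thesis
    using 1 by (simp add: G_coeff_def scale_left_diff_distrib sum_subtractf scale_minus_left scale_left_distrib)
qed

end

context FT_module
begin

lemma Phi_eventually_zero: "\<exists>M. \<forall>m>M. Phi m v = 0"
proof -
  let ?U = "{v. \<exists>M. \<forall>m>M. Phi m v = 0}"
  have "invariant_subspace scale Phi ?U"
    unfolding invariant_subspace_def
  proof (intro conjI allI ballI)
    show "subspace ?U"
    proof (rule subspaceI)
      show "0 \<in> ?U" by (simp add: Phi_zero)
    next
      fix x y assume "x \<in> ?U" "y \<in> ?U"
      then obtain M N where "\<forall>m>M. Phi m x = 0" "\<forall>m>N. Phi m y = 0" by auto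
      then have "\<forall>m>max M N. Phi m (x + y) = 0" by (simp add: Phi_add)
      then show "x + y \<in> ?U" by blast
    next
      fix c x assume "x \<in> ?U"
      then show "scale c x \<in> ?U" by (auto simp: Phi_scale)
    qed
  next
    fix a u assume "u \<in> ?U"
    then obtain M where M: "\<forall>m>M. Phi m u = 0" by auto
    have "Phi m (Phi a u) = 0" if "m > max M (- a)" for m
      using anticommutator[of m a u] M that by (simp add: Phi_zero)
    then show "Phi a u \<in> ?U" by blast
  qed
  moreover have "vac \<in> ?U" using annihilate by blast
  ultimately show ?thesis using generated by blast
qed

lemma linear_FT_action: "Vector_Spaces.linear scale scale (FT_action scale Phi \<chi> x)"
proof (cases x)
  case (G m)
  obtain K where K: "\<And>k. k > K \<Longrightarrow> half_mode \<chi> k = 0" using half_mode_bounded by blast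
  let ?L = "min m (m - K)"
  have win: "\<exists>R0. \<forall>R\<ge>R0. FT_action scale Phi \<chi> (G m) v
      = (\<Sum>j\<in>{?L..R}. scale (G_coeff \<chi> m j) (Phi j v))" for v
  proof -
    obtain M where "\<forall>m>M. Phi m v = 0" using Phi_eventually_zero by blast
    then show ?thesis
      by (intro exI[of _ "max M m"] allI impI G_action_window[OF K]) auto
  qed
  have "FT_action scale Phi \<chi> (G m) (u + v)
      = FT_action scale Phi \<chi> (G m) u + FT_action scale Phi \<chi> (G m) v" for u v
  proof -
    obtain A B D where "\<forall>R\<ge>A. FT_action scale Phi \<chi> (G m) u
        = (\<Sum>j\<in>{?L..R}. scale (G_coeff \<chi> m j) (Phi j u))"
      "\<forall>R\<ge>B. FT_action scale Phi \<chi> (G m) v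
        = (\<Sum>j\<in>{?L..R}. scale (G_coeff \<chi> m j) (Phi j v))"
      "\<forall>R\<ge>D. FT_action scale Phi \<chi> (G m) (u + v)
        = (\<Sum>j\<in>{?L..R}. scale (G_coeff \<chi> m j) (Phi j (u + v)))"
      using win by meson
    from this(1)[rule_format, of "max A (max B D)"] this(2)[rule_format, of "max A (max B D)"]
      this(3)[rule_format, of "max A (max B D)"]
    show ?thesis
      by (simp only: max.cobounded1 max.cobounded2 le_max_iff_disj order_refl simp_thms
          Phi_add scale_right_distrib sum.distrib)
  qed
  moreover have "FT_action scale Phi \<chi> (G m) (scale c v)
      = scale c (FT_action scale Phi \<chi> (G m) v)" for c v
  proof -
    obtain A D where "\<forall>R\<ge>A. FT_action scale Phi \<chi> (G m) v
        = (\<Sum>j\<in>{?L..R}. scale (G_coeff \<chi> m j) (Phi j v))"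
      "\<forall>R\<ge>D. FT_action scale Phi \<chi> (G m) (scale c v)
        = (\<Sum>j\<in>{?L..R}. scale (G_coeff \<chi> m j) (Phi j (scale c v)))"
      using win by meson
    from this(1)[rule_format, of "max A D"] this(2)[rule_format, of "max A D"]
    show ?thesis
      by (simp only: max.cobounded1 max.cobounded2 Phi_scale scale_sum_right scale_scale mult.commute)
  qed
  ultimately show ?thesis
    unfolding G by unfold_locales
qed (unfold_locales; simp add: scale_right_distrib mult.commute)+

lemma G_anticommutator:
  "FT_action scale Phi \<chi> (G a) (FT_action scale Phi \<chi> (G b) v)
     + FT_action scale Phi \<chi> (G b) (FT_action scale Phi \<chi> (G a) v)
   = scale ((-1) powi (a + 1) *
       ((if a + b = 0 then (of_int a / 2 + 1/2) * (of_int b / 2 + 1/2) else 0)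
        - (of_int a / 2 + 1/2 + (-1) powi (a + b) * (of_int b / 2 + 1/2)) * half_mode \<chi> (a + b)
        + Sum_any (\<lambda>j. (-1) powi j * half_mode \<chi> j * half_mode \<chi> (a + b - j)))) v"
proof -
  obtain K where K: "\<And>k. k > K \<Longrightarrow> half_mode \<chi> k = 0" using half_mode_bounded by blast
  obtain M where M: "\<And>m. m > M \<Longrightarrow> Phi m v = 0" using Phi_eventually_zero by blast
  define Q where "Q = \<bar>a\<bar> + \<bar>b\<bar> + \<bar>K\<bar> + \<bar>M\<bar>"
  have Q: "\<bar>m\<bar> + \<bar>K\<bar> \<le> Q" if "m \<in> {a, b}" for m
    using that unfolding Q_def by auto
  have bounds: "- Q \<le> m - K" "- Q \<le> m" "m \<le> Q" if "m \<in> {a, b}" for m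
    using Q[OF that] by linarith+
  have "M \<le> Q" unfolding Q_def by linarith
  let ?I = "{- Q..Q}"
  let ?h = "half_mode \<chi>" and ?c = "G_coeff \<chi>"
  let ?A = "of_int a / 2 + 1/2 :: complex" and ?B = "of_int b / 2 + 1/2 :: complex"
  have one: "FT_action scale Phi \<chi> (G m) v = (\<Sum>k\<in>?I. scale (?c m k) (Phi k v))"
    if "m \<in> {a, b}" for m
    using \<open>M \<le> Q\<close> by (intro G_action_window[OF K _ bounds[OF that]] M) auto
  have two: "FT_action scale Phi \<chi> (G m) (\<Sum>k\<in>?I. scale (d k) (Phi k v))
      = (\<Sum>j\<in>?I. scale (?c m j) (\<Sum>k\<in>?I. scale (d k) (Phi j (Phi k v))))"
    if "m \<in> {a, b}" for m d
  proof -
    have "Phi j (\<Sum>k\<in>?I. scale (d k) (Phi k v)) = 0" if "j > Q" for j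
    proof -
      have "Phi j (Phi k v) = 0" if "k \<in> ?I" for k
      proof -
        have "Phi j v = 0" using M \<open>j > Q\<close> \<open>M \<le> Q\<close> by auto
        then show ?thesis
          using anticommutator[of j k v] that \<open>j > Q\<close> by (simp add: Phi_zero)
      qed
      then show ?thesis by (simp add: Phi_sum Phi_scale)
    qed
    then have "FT_action scale Phi \<chi> (G m) (\<Sum>k\<in>?I. scale (d k) (Phi k v))
      = (\<Sum>j\<in>?I. scale (?c m j) (Phi j (\<Sum>k\<in>?I. scale (d k) (Phi k v))))"
      by (intro G_action_window[OF K _ bounds[OF \<open>m \<in> {a, b}\<close>]]) auto
    then show ?thesis by (simp add: Phi_sum Phi_scale)
  qed
  have "FT_action scale Phi \<chi> (G a) (FT_action scale Phi \<chi> (G b) v)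
     + FT_action scale Phi \<chi> (G b) (FT_action scale Phi \<chi> (G a) v)
     = (\<Sum>j\<in>?I. \<Sum>k\<in>?I. scale (?c a j * ?c b k) (Phi j (Phi k v)))
     + (\<Sum>k\<in>?I. \<Sum>j\<in>?I. scale (?c a j * ?c b k) (Phi k (Phi j v)))"
    by (simp add: one two scale_sum_right mult.commute del: FT_action.simps)
  also have "(\<Sum>k\<in>?I. \<Sum>j\<in>?I. scale (?c a j * ?c b k) (Phi k (Phi j v)))
      = (\<Sum>j\<in>?I. \<Sum>k\<in>?I. scale (?c a j * ?c b k) (Phi k (Phi j v)))"
    by (rule sum.swap)
  also have "(\<Sum>j\<in>?I. \<Sum>k\<in>?I. scale (?c a j * ?c b k) (Phi j (Phi k v))) + \<dots>
      = (\<Sum>j\<in>?I. \<Sum>k\<in>?I. scale (?c a j * ?c b k) (Phi j (Phi k v) + Phi k (Phi j v)))"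
    by (simp add: scale_right_distrib sum.distrib)
  also have "\<dots> = (\<Sum>j\<in>?I. \<Sum>k\<in>?I. if k = - j then scale (- ((-1) powi j) * ?c a j * ?c b (- j)) v else 0)"
    by (intro sum.cong refl) (auto simp: anticommutator mult_ac)
  also have "\<dots> = (\<Sum>j\<in>?I. scale (- ((-1) powi j) * ?c a j * ?c b (- j)) v)"
    by (intro sum.cong refl) auto
  also have "\<dots> = scale (\<Sum>j\<in>?I. - ((-1) powi j) * ?c a j * ?c b (- j)) v"
    by (simp add: scale_sum_left)
  also have "(\<Sum>j\<in>?I. - ((-1) powi j) * ?c a j * ?c b (- j))
     = (\<Sum>j\<in>?I. - ((-1) powi j) * ?h (a - j) * ?h (b + j))
     + (\<Sum>j\<in>?I. if j = a then (-1) powi a * ?A * ?h (a + b) else 0)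
     + (\<Sum>j\<in>?I. if j = - b then (-1) powi b * ?B * ?h (a + b) else 0)
     - (\<Sum>j\<in>?I. if j = a then (if a + b = 0 then (-1) powi a * ?A * ?B else 0) else 0)"
    unfolding sum.distrib[symmetric] sum_subtractf[symmetric]
    by (intro sum.cong refl)
       (auto simp: G_coeff_def algebra_simps power_int_minus_left)
  also have "\<dots> = (\<Sum>j\<in>?I. - ((-1) powi j) * ?h (a - j) * ?h (b + j))
     + (-1) powi a * ?A * ?h (a + b) + (-1) powi b * ?B * ?h (a + b)
     - (if a + b = 0 then (-1) powi a * ?A * ?B else 0)"
  proof -
    have "a \<in> ?I" "- b \<in> ?I" using bounds[of a] bounds[of b] by auto
    then show ?thesis by (simp only: sum.delta finite_atLeastAtMost_int if_True)
  qed
  also have "(\<Sum>j\<in>?I. - ((-1) powi j) * ?h (a - j) * ?h (b + j))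
      = (\<Sum>j\<in>{a - Q..a + Q}. - ((-1) powi a) * ((-1) powi j * ?h j * ?h (a + b - j)))"
    by (rule sum.reindex_bij_witness[of _ "\<lambda>j. a - j" "\<lambda>j. a - j"])
       (auto simp: power_int_minus_left algebra_simps)
  also have "\<dots> = - ((-1) powi a) * (\<Sum>j\<in>{a - Q..a + Q}. (-1) powi j * ?h j * ?h (a + b - j))"
    by (simp only: sum_distrib_left)
  also have "(\<Sum>j\<in>{a - Q..a + Q}. (-1) powi j * ?h j * ?h (a + b - j))
      = Sum_any (\<lambda>j. (-1) powi j * ?h j * ?h (a + b - j))"
  proof (rule Sum_any.expand_superset[symmetric])
    have "j \<in> {a - Q..a + Q}" if "?h j \<noteq> 0" "?h (a + b - j) \<noteq> 0" for j
    proof -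
      have "j \<le> K" "a + b - j \<le> K" using K that by (meson not_le)+
      then show ?thesis by (auto simp: Q_def)
    qed
    then show "{j. (-1) powi j * ?h j * ?h (a + b - j) \<noteq> 0} \<subseteq> {a - Q..a + Q}" by auto
  qed simp
  also have "- ((-1) powi a) * Sum_any (\<lambda>j. (-1) powi j * ?h j * ?h (a + b - j))
     + (-1) powi a * ?A * ?h (a + b) + (-1) powi b * ?B * ?h (a + b)
     - (if a + b = 0 then (-1) powi a * ?A * ?B else 0)
     = (-1) powi (a + 1) * ((if a + b = 0 then ?A * ?B else 0)
        - (?A + (-1) powi (a + b) * ?B) * ?h (a + b)
        + Sum_any (\<lambda>j. (-1) powi j * ?h j * ?h (a + b - j)))"
  proof -
    have "(-1) powi b = ((-1) powi a * (-1) powi (a + b) :: complex)"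
      "(-1) powi (a + 1) = - ((-1) powi a :: complex)"
      by (simp_all add: power_int_minus_left)
    then show ?thesis
      by (simp only: if_distrib[of "\<lambda>x. _ * x"] mult_zero_right) (simp add: algebra_simps)
  qed
  finally show ?thesis .
qed

theorem atw_module_FT_action: "atw_module scale (FT_action scale Phi \<chi>)"
proof -
  let ?\<rho> = "FT_action scale Phi \<chi>" and ?h = "half_mode \<chi>"
  have ext: "(\<Sum>b\<in>Poly_Mapping.keys p. scale (Poly_Mapping.lookup p b) (f b))
      = (\<Sum>b\<in>B. scale (Poly_Mapping.lookup p b) (f b))"
    if "finite B" "Poly_Mapping.keys p \<subseteq> B" for p B and f :: "atw \<Rightarrow> 'v"
    by (rule sum.mono_neutral_left) (use that in \<open>auto simp: not_in_keys_iff_lookup_eq_zero\<close>)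
  have commute: "?\<rho> x (?\<rho> y v) - scale (if odd_atw x \<and> odd_atw y then -1 else 1) (?\<rho> y (?\<rho> x v)) = 0"
    if "\<not> odd_atw x \<or> \<not> odd_atw y" for x y v
  proof -
    have scalar: "\<exists>c. \<forall>v. ?\<rho> x v = scale c v" if "\<not> odd_atw x" for x
    proof (cases x)
      case (G m)
      then show ?thesis using that by simp
    qed (simp_all only: FT_action.simps, blast+)
    have lin: "?\<rho> x (scale c v) = scale c (?\<rho> x v)" for x c v
    proof -
      interpret L: Vector_Spaces.linear scale scale "?\<rho> x" by (rule linear_FT_action)
      show ?thesis by (rule L.scale)
    qed
    show ?thesis
    proof (cases "odd_atw x")
      case True
      then have "\<not> odd_atw y" using that by simp
      from scalar[OF this] obtain c where "\<forall>v. ?\<rho> y v = scale c v" by blast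
      then show ?thesis using that by (auto simp: lin simp del: FT_action.simps)
    next
      case False
      from scalar[OF this] obtain c where "\<forall>v. ?\<rho> x v = scale c v" by blast
      then show ?thesis using that by (auto simp: lin simp del: FT_action.simps)
    qed
  qed
  have GG: "?\<rho> (G a) (?\<rho> (G b) v) + ?\<rho> (G b) (?\<rho> (G a) v) =
      (\<Sum>x\<in>Poly_Mapping.keys (atw_bracket (G a) (G b)).
         scale (Poly_Mapping.lookup (atw_bracket (G a) (G b)) x) (?\<rho> x v))" for a b v
  proof (cases "even (a + b)")
    case True
    then obtain n where n: "a + b = 2 * n" by blast
    have b: "b = 2 * n - a" using n by simp
    let ?s = "(-1) powi (a + 1) :: complex"
    let ?p = "atw_bracket (G a) (G b)"
    let ?c = "if n = 0 then ?s * (((of_int a / 2)\<^sup>2 - 1/4) / 3) else 0 :: complex"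
    have p: "?p = Poly_Mapping.single (S n) (?s * 2) + Poly_Mapping.single C ?c"
      using True by (simp add: Let_def n)
    have "(\<Sum>x\<in>Poly_Mapping.keys ?p. scale (Poly_Mapping.lookup ?p x) (?\<rho> x v))
        = (\<Sum>x\<in>{S n, C}. scale (Poly_Mapping.lookup ?p x) (?\<rho> x v))"
      unfolding p by (rule ext, simp, rule order_trans[OF Poly_Mapping.keys_add]) auto
    also have "\<dots> = scale (?s * 2) (?\<rho> (S n) v) + scale ?c (?\<rho> C v)"
      by (simp add: p lookup_add lookup_single when_def del: atw_bracket.simps FT_action.simps)
    also have "\<dots> = scale (?s * (Sum_any (\<lambda>j. (-1) powi j * ?h j * ?h (2 * n - j))
             - (of_int n + 1) * ?h (2 * n)) - 3 * ?c) v"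
      by (simp add: scale_left_diff_distrib)
    also have "?s * (Sum_any (\<lambda>j. (-1) powi j * ?h j * ?h (2 * n - j))
             - (of_int n + 1) * ?h (2 * n)) - 3 * ?c
       = (-1) powi (a + 1) *
       ((if a + b = 0 then (of_int a / 2 + 1/2) * (of_int b / 2 + 1/2) else 0)
        - (of_int a / 2 + 1/2 + (-1) powi (a + b) * (of_int b / 2 + 1/2)) * ?h (a + b)
        + Sum_any (\<lambda>j. (-1) powi j * ?h j * ?h (a + b - j)))"
      unfolding n by (simp add: b power2_eq_square field_simps)
    finally show ?thesis unfolding G_anticommutator by simp
  next
    case False
    define n where "n = (a + b - 1) div 2"
    have n: "a + b = 2 * n + 1" using False unfolding n_def by presburger
    let ?c = "- ((-1) powi (a + 1)) * (of_int a / 2 - of_int b / 2) :: complex"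
    let ?p = "atw_bracket (G a) (G b)"
    have p: "?p = Poly_Mapping.single (T n) ?c"
      using False by (simp add: Let_def n)
    have "(\<Sum>x\<in>Poly_Mapping.keys ?p. scale (Poly_Mapping.lookup ?p x) (?\<rho> x v))
        = (\<Sum>x\<in>{T n}. scale (Poly_Mapping.lookup ?p x) (?\<rho> x v))"
      unfolding p by (rule ext) auto
    also have "\<dots> = scale (?c * ?h (2 * n + 1)) v"
      by (simp add: p del: atw_bracket.simps)
    also have "?c * ?h (2 * n + 1) = (-1) powi (a + 1) *
       ((if a + b = 0 then (of_int a / 2 + 1/2) * (of_int b / 2 + 1/2) else 0)
        - (of_int a / 2 + 1/2 + (-1) powi (a + b) * (of_int b / 2 + 1/2)) * ?h (a + b)
        + Sum_any (\<lambda>j. (-1) powi j * ?h j * ?h (a + b - j)))"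
    proof -
      have "a + b \<noteq> 0" and "odd (a + b)" using n by presburger+
      moreover have "(-1 :: complex) powi (a + b) = - 1"
        using \<open>odd (a + b)\<close> by (simp add: power_int_minus_left)
      ultimately show ?thesis
        by (simp only: odd_convolution_zero[OF \<open>odd (a + b)\<close>] n[symmetric] if_False)
          (simp add: algebra_simps)
    qed
    finally show ?thesis unfolding G_anticommutator by simp
  qed
  show ?thesis
  proof (intro atw_module.intro atw_module_axioms.intro, goal_cases)
    case 1
    show ?case by (rule vector_space_axioms)
  next
    case (2 x)
    show ?case by (rule linear_FT_action)
  next
    case (3 x y v)
    show ?case
    proof (cases "odd_atw x \<and> odd_atw y")
      case True
      then obtain a b where "x = G a" "y = G b" by (cases x; cases y) auto
      then show ?thesis
        using GG[of a b v] by (simp add: scale_minus_left del: FT_action.simps atw_bracket.simps)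
    next
      case False
      then have "atw_bracket x y = 0" by (cases x; cases y) auto
      then show ?thesis using commute[of x y v] False by (auto simp del: FT_action.simps)
    qed
  qed
qed

end

section \<open>The modules exist\<close>

text \<open>
  The exterior algebra on \<open>\<Phi>(r)\<close>, \<open>r < 0\<close>: the finite set \<open>A\<close> of naturals stands for the ordered
  monomial in the \<open>Phi (- int k - 1)\<close>, \<open>k\<close> in \<open>A\<close>, with \<open>k\<close> increasing from left to right.
\<close>

type_synonym fock = "nat fset \<Rightarrow>\<^sub>0 complex"

lift_definition fock_scale :: "complex \<Rightarrow> fock \<Rightarrow> fock" is "\<lambda>c f A. c * f A"
  by (rule finite_subset) auto

definition ext_sign :: "nat \<Rightarrow> nat fset \<Rightarrow> complex" where
  "ext_sign k A = (-1) ^ card {a \<in> fset A. a < k}"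

lift_definition create :: "nat \<Rightarrow> fock \<Rightarrow> fock"
  is "\<lambda>k f A. if k |\<in>| A then ext_sign k A * f (A |-| {|k|}) else 0"
proof -
  fix k :: nat and f :: "nat fset \<Rightarrow> complex"
  assume "finite {x. f x \<noteq> 0}"
  moreover
  have "A \<in> finsert k ` {x. f x \<noteq> 0}"
    if "(if k |\<in>| A then ext_sign k A * f (A |-| {|k|}) else 0) \<noteq> 0" for A
    using that by (intro image_eqI[of _ _ "A |-| {|k|}"]) (auto split: if_splits)
  then have "{A. (if k |\<in>| A then ext_sign k A * f (A |-| {|k|}) else 0) \<noteq> 0} \<subseteq> finsert k ` {x. f x \<noteq> 0}"
    by blast
  ultimately show "finite {A. (if k |\<in>| A then ext_sign k A * f (A |-| {|k|}) else 0) \<noteq> 0}"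
    by (blast intro: finite_subset)
qed

lift_definition destroy :: "nat \<Rightarrow> fock \<Rightarrow> fock"
  is "\<lambda>k f A. if k |\<notin>| A then ext_sign k A * f (finsert k A) else 0"
proof -
  fix k :: nat and f :: "nat fset \<Rightarrow> complex"
  assume "finite {x. f x \<noteq> 0}"
  moreover
  have "A \<in> (\<lambda>B. B |-| {|k|}) ` {x. f x \<noteq> 0}"
    if "(if k |\<notin>| A then ext_sign k A * f (finsert k A) else 0) \<noteq> 0" for A
    using that by (intro image_eqI[of _ _ "finsert k A"]) (auto split: if_splits)
  then have "{A. (if k |\<notin>| A then ext_sign k A * f (finsert k A) else 0) \<noteq> 0} \<subseteq> (\<lambda>B. B |-| {|k|}) ` {x. f x \<noteq> 0}"
    by blast
  ultimately show "finite {A. (if k |\<notin>| A then ext_sign k A * f (finsert k A) else 0) \<noteq> 0}"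
    by (blast intro: finite_subset)
qed

lift_definition parity_op :: "fock \<Rightarrow> fock" is "\<lambda>f A. (-1) ^ fcard A * f A"
  by (rule finite_subset) auto

definition zero_eigenvalue :: "nat \<Rightarrow> complex" where
  "zero_eigenvalue i = (-1) ^ i * (1 / csqrt (-2))"

definition fock_Phi :: "nat \<Rightarrow> int \<Rightarrow> fock \<Rightarrow> fock" where
  "fock_Phi i m f =
     (if m < 0 then create (nat (- m - 1)) f
      else if m > 0 then fock_scale (- ((-1) powi m)) (destroy (nat (m - 1)) f)
      else fock_scale (zero_eigenvalue i) (parity_op f))"

lemma ext_sign_finsert: "ext_sign k (finsert l A) = (if l |\<in>| A \<or> k \<le> l then 1 else -1) * ext_sign k A"
proof (cases "l |\<notin>| A \<and> l < k")
  case True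
  then have "{a \<in> fset (finsert l A). a < k} = insert l {a \<in> fset A. a < k}" by auto
  then show ?thesis using True by (simp add: ext_sign_def)
next
  case False
  then have eq: "{a \<in> fset (finsert l A). a < k} = {a \<in> fset A. a < k}" by auto
  show ?thesis unfolding ext_sign_def eq using False by auto
qed

lemma ext_sign_fminus:
  "ext_sign k (A |-| {|l|}) = (if l |\<notin>| A \<or> k \<le> l then 1 else -1) * ext_sign k A"
proof (cases "l |\<in>| A")
  case True
  then have eq: "finsert l (A |-| {|l|}) = A" by (rule finsert_fminus)
  have "ext_sign k A = (if k \<le> l then 1 else -1) * ext_sign k (A |-| {|l|})"
    using ext_sign_finsert[of k l "A |-| {|l|}"] unfolding eq by simp
  with True show ?thesis by (cases "k \<le> l") simp_all
next
  case False
  then have "A |-| {|l|} = A" by auto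
  with False show ?thesis by simp
qed

lemma ext_sign_square: "ext_sign k A * ext_sign k A = 1" "ext_sign k A * (ext_sign k A * z) = z"
proof -
  show "ext_sign k A * ext_sign k A = 1"
    by (simp add: ext_sign_def minus_one_power_iff)
  then show "ext_sign k A * (ext_sign k A * z) = z"
    by (simp flip: mult.assoc)
qed

lemma lookup_simps:
  "Poly_Mapping.lookup (fock_scale c f) A = c * Poly_Mapping.lookup f A"
  "Poly_Mapping.lookup (create k f) A =
     (if k |\<in>| A then ext_sign k A * Poly_Mapping.lookup f (A |-| {|k|}) else 0)"
  "Poly_Mapping.lookup (destroy k f) A =
     (if k |\<notin>| A then ext_sign k A * Poly_Mapping.lookup f (finsert k A) else 0)"
  "Poly_Mapping.lookup (parity_op f) A = (-1) ^ fcard A * Poly_Mapping.lookup f A"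
  by (transfer, simp)+

lemma fock_vector_space: "vector_space fock_scale"
  by unfold_locales (auto intro!: poly_mapping_eqI simp: lookup_simps lookup_add algebra_simps)

lemma create_create: "create k (create l f) + create l (create k f) = 0"
proof (rule poly_mapping_eqI)
  fix A
  have "A |-| {|k|} |-| {|l|} = A |-| {|l|} |-| {|k|}" by auto
  then show "Poly_Mapping.lookup (create k (create l f) + create l (create k f)) A
      = Poly_Mapping.lookup 0 A"
    by (auto simp: lookup_add lookup_simps ext_sign_fminus)
qed

lemma destroy_destroy: "destroy k (destroy l f) + destroy l (destroy k f) = 0"
proof (rule poly_mapping_eqI)
  fix A
  have "finsert k (finsert l A) = finsert l (finsert k A)" by auto
  then show "Poly_Mapping.lookup (destroy k (destroy l f) + destroy l (destroy k f)) A
      = Poly_Mapping.lookup 0 A"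
    by (auto simp: lookup_add lookup_simps ext_sign_finsert)
qed

lemma create_destroy: "create k (destroy l f) + destroy l (create k f) = (if k = l then f else 0)"
proof (rule poly_mapping_eqI)
  fix A
  show "Poly_Mapping.lookup (create k (destroy l f) + destroy l (create k f)) A
      = Poly_Mapping.lookup (if k = l then f else 0) A"
  proof (cases "k = l")
    case True
    have "finsert k (A |-| {|k|}) = A" if "k |\<in>| A" using that by (rule finsert_fminus)
    moreover have "finsert k A |-| {|k|} = A" if "k |\<notin>| A" using that by auto
    ultimately show ?thesis
      using True
      by (auto simp: lookup_add lookup_simps ext_sign_finsert ext_sign_fminus ext_sign_square)
  next
    case False
    have "finsert l (A |-| {|k|}) = finsert l A |-| {|k|}" using False by auto
    then show ?thesis
      using False by (auto simp: lookup_add lookup_simps ext_sign_finsert ext_sign_fminus)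
  qed
qed

lemma parity_create: "parity_op (create k f) + create k (parity_op f) = 0"
proof (rule poly_mapping_eqI)
  fix A
  have "(-1 :: complex) ^ fcard A = - ((-1) ^ fcard (A |-| {|k|}))" if "k |\<in>| A"
  proof -
    have "fcard A = Suc (fcard (A |-| {|k|}))" using that by (metis fcard_Suc_fminus1)
    then show ?thesis by simp
  qed
  then show "Poly_Mapping.lookup (parity_op (create k f) + create k (parity_op f)) A
      = Poly_Mapping.lookup 0 A"
    by (auto simp: lookup_add lookup_simps)
qed

lemma parity_destroy: "parity_op (destroy k f) + destroy k (parity_op f) = 0"
  by (rule poly_mapping_eqI) (auto simp: lookup_add lookup_simps fcard_finsert_disjoint)

lemma parity_parity: "parity_op (parity_op f) = f"
  by (rule poly_mapping_eqI) (simp add: lookup_simps minus_one_power_iff)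

lemma fock_linear:
  "create k (fock_scale c f) = fock_scale c (create k f)"
  "destroy k (fock_scale c f) = fock_scale c (destroy k f)"
  "parity_op (fock_scale c f) = fock_scale c (parity_op f)"
  "create k (- f) = - create k f"
  "destroy k (- f) = - destroy k f"
  "parity_op (- f) = - parity_op f"
  "create k (f + g) = create k f + create k g"
  "destroy k (f + g) = destroy k f + destroy k g"
  "parity_op (f + g) = parity_op f + parity_op g"
  by (auto intro!: poly_mapping_eqI simp: lookup_simps lookup_add algebra_simps)

lemma zero_eigenvalue_square: "zero_eigenvalue i * zero_eigenvalue i = - (1 / 2)"
proof -
  have "zero_eigenvalue i * zero_eigenvalue i = (zero_eigenvalue i)\<^sup>2"
    by (simp add: power2_eq_square)
  also have "\<dots> = - (1 / 2)"
    unfolding zero_eigenvalue_def power_mult_distrib power_divide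
    by (simp add: power_mult_distrib flip: power_mult of_real_power)
  finally show ?thesis .
qed

lemma fock_cltw_module: "cltw_module fock_scale (fock_Phi i)"
proof (intro cltw_module.intro cltw_module_axioms.intro)
  interpret vector_space fock_scale by (rule fock_vector_space)
  show "vector_space fock_scale" by unfold_locales
  show "Vector_Spaces.linear fock_scale fock_scale (fock_Phi i a)" for a
    by unfold_locales
      (auto simp: fock_Phi_def fock_linear scale_right_distrib mult.commute)
  fix a b :: int and f :: fock
  have pos_neg: "fock_Phi i a (fock_Phi i b f) + fock_Phi i b (fock_Phi i a f)
      = fock_scale (if a + b = 0 then - ((-1) powi a) else 0) f" if "a > 0" "b < 0" for a b
  proof -
    have "fock_Phi i a (fock_Phi i b f) + fock_Phi i b (fock_Phi i a f)
       = fock_scale (- ((-1) powi a)) (create (nat (- b - 1)) (destroy (nat (a - 1)) f)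
           + destroy (nat (a - 1)) (create (nat (- b - 1)) f))"
      using that by (simp add: fock_Phi_def fock_linear scale_right_distrib add.commute)
    also have "\<dots> = fock_scale (if a + b = 0 then - ((-1) powi a) else 0) f"
      unfolding create_destroy using that by auto
    finally show ?thesis .
  qed
  have zero: "fock_Phi i 0 (fock_Phi i b f) + fock_Phi i b (fock_Phi i 0 f) = 0" if "b \<noteq> 0" for b
  proof (cases "b < 0")
    case True
    have "fock_Phi i 0 (fock_Phi i b f) + fock_Phi i b (fock_Phi i 0 f)
      = fock_scale (zero_eigenvalue i) (parity_op (create (nat (- b - 1)) f)
          + create (nat (- b - 1)) (parity_op f))"
      using True by (simp add: fock_Phi_def fock_linear scale_right_distrib)
    then show ?thesis by (simp add: parity_create)
  next
    case False
    have "fock_Phi i 0 (fock_Phi i b f) + fock_Phi i b (fock_Phi i 0 f)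
      = fock_scale (- ((-1) powi b) * zero_eigenvalue i) (parity_op (destroy (nat (b - 1)) f)
          + destroy (nat (b - 1)) (parity_op f))"
      using False that by (simp add: fock_Phi_def fock_linear scale_right_distrib mult.commute)
    then show ?thesis by (simp add: parity_destroy)
  qed
  consider "a = 0" "b = 0" | "a = 0" "b \<noteq> 0" | "a \<noteq> 0" "b = 0" | "a > 0" "b < 0" | "a < 0" "b > 0"
    | "a > 0" "b > 0" | "a < 0" "b < 0" by linarith
  then show "fock_Phi i a (fock_Phi i b f) + fock_Phi i b (fock_Phi i a f)
      = fock_scale (if a + b = 0 then - ((-1) powi a) else 0) f"
  proof cases
    case 1
    then have "fock_Phi i a (fock_Phi i b f) + fock_Phi i b (fock_Phi i a f)
      = fock_scale (- (1 / 2)) f + fock_scale (- (1 / 2)) f"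
      by (simp add: fock_Phi_def fock_linear parity_parity zero_eigenvalue_square)
    also have "\<dots> = fock_scale (- 1) f"
      by (simp only: scale_left_distrib[symmetric]) simp
    finally show ?thesis using 1 by simp
  next
    case 2
    then show ?thesis using zero[of b] by simp
  next
    case 3
    then show ?thesis using zero[of a] by (simp add: add.commute)
  next
    case 4
    then show ?thesis by (rule pos_neg)
  next
    case 5
    then have "fock_Phi i a (fock_Phi i b f) + fock_Phi i b (fock_Phi i a f)
      = fock_scale (if b + a = 0 then - ((-1) powi b) else 0) f"
      using pos_neg[of b a] by (simp only: add.commute)
    moreover have "(-1 :: complex) powi b = (-1) powi a" if "b + a = 0"
      using that by (metis add_eq_0_iff power_int_minus_one_minus)
    ultimately show ?thesis by (simp add: add.commute)
  next
    case 6
    have "fock_Phi i a (fock_Phi i b f) + fock_Phi i b (fock_Phi i a f)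
      = fock_scale ((-1) powi a * (-1) powi b) (destroy (nat (a - 1)) (destroy (nat (b - 1)) f)
          + destroy (nat (b - 1)) (destroy (nat (a - 1)) f))"
      using 6 by (simp add: fock_Phi_def fock_linear scale_right_distrib mult.commute)
    then show ?thesis using 6 by (simp add: destroy_destroy)
  next
    case 7
    then show ?thesis by (simp add: fock_Phi_def create_create)
  qed
qed

definition fock_vac :: fock where "fock_vac = Poly_Mapping.single {||} 1"

lemma fock_generated:
  assumes "invariant_subspace fock_scale (fock_Phi i) U" "fock_vac \<in> U"
  shows "U = UNIV"
proof -
  interpret vector_space fock_scale by (rule fock_vector_space)
  have U: "subspace U" "\<And>m u. u \<in> U \<Longrightarrow> fock_Phi i m u \<in> U"
    using assms(1) by (auto simp: invariant_subspace_def)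
  have mono: "Poly_Mapping.single A 1 \<in> U" for A
  proof (induction A rule: fset_induct_stronger)
    case empty
    then show ?case using assms(2) by (simp add: fock_vac_def)
  next
    case (insert k A)
    have "create k (Poly_Mapping.single A 1) \<in> U"
      using U(2)[OF insert.IH, of "- int k - 1"] by (simp add: fock_Phi_def)
    then have "fock_scale (ext_sign k A) (create k (Poly_Mapping.single A 1)) \<in> U"
      by (rule subspace_scale[OF U(1)])
    also have "fock_scale (ext_sign k A) (create k (Poly_Mapping.single A 1))
        = Poly_Mapping.single (finsert k A) 1"
    proof (rule poly_mapping_eqI)
      fix B
      have "k |\<notin>| A" by (rule insert.hyps)
      show "Poly_Mapping.lookup (fock_scale (ext_sign k A) (create k (Poly_Mapping.single A 1))) B
        = Poly_Mapping.lookup (Poly_Mapping.single (finsert k A) 1) B"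
      proof (cases "B = finsert k A")
        case True
        then have "B |-| {|k|} = A" using \<open>k |\<notin>| A\<close> by (simp add: fminus_finsert_absorb)
        then show ?thesis
          using True \<open>k |\<notin>| A\<close> by (simp add: lookup_simps ext_sign_finsert ext_sign_square)
      next
        case False
        then have "B |-| {|k|} \<noteq> A" if "k |\<in>| B"
          using finsert_fminus[OF that] by metis
        then show ?thesis using False by (auto simp: lookup_simps lookup_single when_def)
      qed
    qed
    finally show ?case .
  qed
  have "f \<in> U" for f
  proof -
    have "f = (\<Sum>A\<in>Poly_Mapping.keys f. fock_scale (Poly_Mapping.lookup f A) (Poly_Mapping.single A 1))"
      by (rule poly_mapping_eqI)
        (auto simp: lookup_sum lookup_simps lookup_single when_def not_in_keys_iff_lookup_eq_zero if_distrib
          sum.delta cong: if_cong)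
    also have "\<dots> \<in> U" by (intro subspace_sum subspace_scale U(1) mono)
    finally show ?thesis .
  qed
  then show ?thesis by auto
qed

lemma fock_irreducible: "irreducible_action fock_scale (fock_Phi i)"
  unfolding irreducible_action_def
proof (intro allI impI)
  fix U assume inv: "invariant_subspace fock_scale (fock_Phi i) U"
  interpret vector_space fock_scale by (rule fock_vector_space)
  have U: "subspace U" "\<And>m u. u \<in> U \<Longrightarrow> fock_Phi i m u \<in> U"
    using inv by (auto simp: invariant_subspace_def)
  have destroy_U: "destroy k u \<in> U" if "u \<in> U" for k u
  proof -
    have "fock_scale (- ((-1) powi (int k + 1))) (fock_Phi i (int k + 1) u) \<in> U"
      by (intro subspace_scale U that)
    also have "fock_scale (- ((-1) powi (int k + 1))) (fock_Phi i (int k + 1) u) = destroy k u"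
      by (simp add: fock_Phi_def power_int_minus_left)
    finally show ?thesis .
  qed
  have vac: "fock_vac \<in> U"
    if "f \<in> U" "f \<noteq> 0" "\<forall>A. Poly_Mapping.lookup f A \<noteq> 0 \<longrightarrow> fcard A \<le> n" for f n
    using that
  proof (induction n arbitrary: f)
    case (0 f)
    have "f = fock_scale (Poly_Mapping.lookup f {||}) fock_vac"
      using 0 by (intro poly_mapping_eqI) (auto simp: lookup_simps fock_vac_def lookup_single when_def)
    moreover from this have "Poly_Mapping.lookup f {||} \<noteq> 0" using \<open>f \<noteq> 0\<close> by auto
    ultimately show ?case
      using subspace_scale[OF U(1) \<open>f \<in> U\<close>, of "1 / Poly_Mapping.lookup f {||}"]
      by (metis divide_self_if scale_one scale_scale times_divide_eq_left mult_1)
  next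
    case (Suc n f)
    show ?case
    proof (cases "\<exists>k. destroy k f \<noteq> 0")
      case True
      then obtain k where "destroy k f \<noteq> 0" by blast
      moreover have "fcard A \<le> n" if "Poly_Mapping.lookup (destroy k f) A \<noteq> 0" for A
      proof -
        have "k |\<notin>| A" "Poly_Mapping.lookup f (finsert k A) \<noteq> 0"
          using that by (auto simp: lookup_simps split: if_splits)
        then show ?thesis using Suc.prems(3) by (auto simp: fcard_finsert_disjoint)
      qed
      ultimately show ?thesis using destroy_U[OF Suc.prems(1)] by (intro Suc.IH) auto
    next
      case False
      have "Poly_Mapping.lookup f A = 0" if "A \<noteq> {||}" for A
      proof -
        obtain k where "k |\<in>| A" using \<open>A \<noteq> {||}\<close> ex_fin_conv[of A] by blast
        define B where "B = A |-| {|k|}"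
        have A: "A = finsert k B" "k |\<notin>| B"
          using finsert_fminus[OF \<open>k |\<in>| A\<close>] by (simp_all add: B_def)
        then have "Poly_Mapping.lookup (destroy k f) B = 0" using False by auto
        then show ?thesis using A by (simp add: lookup_simps ext_sign_def)
      qed
      then have "fcard A \<le> n" if "Poly_Mapping.lookup f A \<noteq> 0" for A
        using that by (cases "A = {||}") (auto simp: fcard_fempty)
      then show ?thesis using Suc.prems by (intro Suc.IH) auto
    qed
  qed
  show "U = {0} \<or> U = UNIV"
  proof (rule disjCI)
    assume "U \<noteq> UNIV"
    show "U = {0}"
    proof (rule ccontr)
      assume "U \<noteq> {0}"
      then obtain f where f: "f \<in> U" "f \<noteq> 0" using subspace_0[OF U(1)] by blast
      have "\<forall>A. Poly_Mapping.lookup f A \<noteq> 0 \<longrightarrow> fcard A \<le> Max (fcard ` Poly_Mapping.keys f)"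
        by (simp add: lookup_not_eq_zero_eq_in_keys)
      then have "fock_vac \<in> U" using vac f by blast
      then show False using fock_generated[OF inv] \<open>U \<noteq> UNIV\<close> by blast
    qed
  qed
qed

theorem FT_module_exists: "FT_module fock_scale (fock_Phi i) fock_vac i"
proof (intro FT_module.intro FT_module_axioms.intro)
  show "cltw_module fock_scale (fock_Phi i)" by (rule fock_cltw_module)
  show "fock_vac \<noteq> 0"
    by (metis fock_vac_def lookup_single_eq lookup_zero one_neq_zero)
  show "irreducible_action fock_scale (fock_Phi i)" by (rule fock_irreducible)
  show "U = UNIV" if "invariant_subspace fock_scale (fock_Phi i) U" "fock_vac \<in> U" for U
    using that by (rule fock_generated)
  show "fock_Phi i m fock_vac = 0" if "m > 0" for m
    using that by (intro poly_mapping_eqI)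
      (auto simp: fock_Phi_def fock_vac_def lookup_simps lookup_single when_def)
  show "fock_Phi i 0 fock_vac = fock_scale ((-1) ^ i * (1 / csqrt (-2))) fock_vac"
    by (intro poly_mapping_eqI)
      (auto simp: fock_Phi_def fock_vac_def zero_eigenvalue_def lookup_simps lookup_single when_def fcard.rep_eq)
qed

end

(*
  In doubled indices G(m) is a combination of the Phi(j), j >= m, with leading coefficient
  (N - m)/2, which vanishes only for m = N.  Hence the G(m) span a hyperplane in the completed
  span of the Phi(j), the kernel of the functional lam with lam(Phi(N)) = 1; its values
  lam(Phi(N - k)) are the Schur polynomials S_k in all modes -2 chi_{-n/2}, integral or not.
  The vector f orthogonal to this hyperplane is again a sum of modes; it anticommutes with
  every G(m), and f^2 = -D/2 with D = sum_j (-1)^j lam_j lam_{-j}.  The generating function of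
  the S_k times its reflection y -> -y is a series in y^2, whence D = (-1)^N S_N with S_N
  evaluated at the integral modes.

  If D = 0, the kernel of f is a proper nonzero invariant subspace.  If D is nonzero, the G(m)
  and f together generate the Phi(j).  For U invariant under the G(m), the subspaces U + fU and
  {u in U. f u in U} are then trivial, so a proper nonzero U would give a direct sum F = U + fU.
  The operator a + f b |-> f a - f^2 b would anticommute with all Phi(j).  But such an operator
  is zero: it anticommutes with the odd volume elements
  Phi(0) prod_{0 < m <= M} (1 + 2 (-1)^m Phi(-m) Phi(m)), and these act on each vector,
  for M large, as a fixed nonzero scalar.
*)
theory Submission
  imports Defs
begin

section \<open>Schur polynomials\<close>

text \<open>The equation expresses each coefficient of \<open>H\<close> through lower ones;
  characteristic zero allows the division.\<close>

lemma fps_linear_ode_eq_zero: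
  fixes H :: "'a::field_char_0 fps"
  assumes "fps_deriv H = H * B" "H $ 0 = 0"
  shows "H = 0"
proof (rule fps_ext)
  show "H $ n = 0 $ n" for n
  proof (induction n rule: less_induct)
    case (less n)
    show ?case
    proof (cases n)
      case 0
      then show ?thesis using assms(2) by simp
    next
      case (Suc k)
      have "of_nat (Suc k) * H $ Suc k = fps_deriv H $ k" by simp
      also have "\<dots> = (\<Sum>i=0..k. H $ i * B $ (k - i))"
        unfolding assms(1) by (rule fps_mult_nth)
      also have "\<dots> = 0" using less.IH Suc by (intro sum.neutral) simp
      finally show ?thesis using Suc by (simp del: of_nat_Suc)
    qed
  qed
qed

text \<open>Both sides solve \<open>H' = H (A + B)'\<close> with constant term 1.\<close>

lemma fps_exp_compose_plus:
  fixes A B :: "'a::field_char_0 fps"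
  assumes "A $ 0 = 0" "B $ 0 = 0"
  shows "(fps_exp 1 oo A) * (fps_exp 1 oo B) = fps_exp 1 oo (A + B)"
proof -
  let ?H = "(fps_exp 1 oo A) * (fps_exp 1 oo B) - (fps_exp 1 oo (A + B))"
  have "fps_deriv ?H = ?H * fps_deriv (A + B)"
    using assms by (simp add: fps_compose_deriv algebra_simps)
  then have "?H = 0"
    by (rule fps_linear_ode_eq_zero) simp
  then show ?thesis by simp
qed

section \<open>Generating function of the Schur polynomials\<close>

definition power_sum_series :: "(nat \<Rightarrow> 'a::field_char_0) \<Rightarrow> 'a fps" where
  "power_sum_series x = Abs_fps (\<lambda>n. if n = 0 then 0 else x n / of_nat n)"

lemma power_sum_series_0: "power_sum_series x $ 0 = 0"
  by (simp add: power_sum_series_def)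

lemma schur_eq: "schur r x = (fps_exp 1 oo power_sum_series x) $ r"
  by (simp add: schur_def power_sum_series_def)

lemma schur_0: "schur 0 x = 1"
  by (simp add: schur_eq)

text \<open>Coefficient of \<open>y^(r-1)\<close> in \<open>E' = P' E\<close>, where
  \<open>E = exp P\<close> is the generating function.\<close>

lemma schur_recurrence: "of_nat r * schur r x = (\<Sum>k=1..r. x k * schur (r - k) x)"
proof (cases r)
  case (Suc n)
  let ?P = "power_sum_series x"
  have "of_nat r * schur r x = fps_deriv (fps_exp 1 oo ?P) $ n"
    by (simp add: Suc schur_eq)
  also have "\<dots> = (fps_deriv ?P * (fps_exp 1 oo ?P)) $ n"
    by (simp add: fps_compose_deriv power_sum_series_0 mult.commute)
  also have "\<dots> = (\<Sum>i=0..n. x (Suc i) * schur (n - i) x)"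
    by (simp add: fps_mult_nth schur_eq power_sum_series_def del: of_nat_Suc)
  also have "\<dots> = (\<Sum>k=Suc 0..Suc n. x k * schur (Suc n - k) x)"
    by (subst sum.shift_bounds_cl_Suc_ivl) simp
  finally show ?thesis by (simp add: Suc)
qed simp

text \<open>
  The product of the generating function with its reflection under \<open>y \<mapsto> - y\<close> is a series in
  \<open>y\<^sup>2\<close>, because only the even arguments survive in the exponent.
\<close>

lemma schur_even_arguments:
  "schur r (\<lambda>k. x (2 * k)) = (\<Sum>i=0..2 * r. (- 1) ^ i * schur i x * schur (2 * r - i) x)"
proof -
  let ?P = "power_sum_series x"
  let ?E = "power_sum_series (\<lambda>k. x (2 * k))"
  \<comment> \<open>Odd terms cancel and even terms double, which turns
    \<open>x (2 * m) / (2 * m)\<close> into \<open>x (2 * m) / m\<close>.\<close>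
  have sum: "(?P oo - fps_X) + ?P = ?E oo fps_X ^ 2"
  proof (rule fps_ext)
    fix n
    show "((?P oo - fps_X) + ?P) $ n = (?E oo fps_X ^ 2) $ n"
    proof (cases "even n")
      case True
      then obtain m where "n = 2 * m" by blast
      then show ?thesis
        by (simp add: fps_nth_compose_X_power fps_compose_uminus' power_sum_series_def)
    next
      case False
      then show ?thesis
        by (simp add: fps_nth_compose_X_power fps_compose_uminus' odd_pos[of n])
    qed
  qed
  have "(fps_exp 1 oo ?P oo - fps_X) * (fps_exp 1 oo ?P)
      = (fps_exp 1 oo (?P oo - fps_X)) * (fps_exp 1 oo ?P)"
    by (simp add: fps_compose_assoc power_sum_series_0)
  also have "\<dots> = fps_exp 1 oo (?E oo fps_X ^ 2)"
    by (subst fps_exp_compose_plus) (simp_all add: power_sum_series_0 sum)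
  also have "\<dots> = fps_exp 1 oo ?E oo fps_X ^ 2"
    by (simp add: fps_compose_assoc power_sum_series_0)
  finally have "((fps_exp 1 oo ?P oo - fps_X) * (fps_exp 1 oo ?P)) $ (2 * r)
      = (fps_exp 1 oo ?E oo fps_X ^ 2) $ (2 * r)"
    by (rule arg_cong)
  then show ?thesis
    by (simp add: fps_mult_nth fps_nth_compose_X_power fps_compose_uminus' schur_eq)
qed

section \<open>Sums of modes and volume elements\<close>

context cltw_module
begin

text \<open>\<open>Sum_any\<close> returns 0 on infinite support, so \<open>d\<close> is meant to
  vanish far below; where \<open>Phi j v = 0\<close> for large \<open>j\<close>, finitely many terms
  then remain.\<close>

definition mode_sum :: "(int \<Rightarrow> complex) \<Rightarrow> 'v \<Rightarrow> 'v" where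
  "mode_sum d v = Sum_any (\<lambda>j. scale (d j) (Phi j v))"

lemma mode_sum_window:
  assumes "\<And>j. j < L \<Longrightarrow> d j = 0" "\<And>j. j > R \<Longrightarrow> Phi j v = 0"
  shows "mode_sum d v = (\<Sum>j\<in>{L..R}. scale (d j) (Phi j v))"
  unfolding mode_sum_def
proof (rule Sum_any.expand_superset)
  show "{j. scale (d j) (Phi j v) \<noteq> 0} \<subseteq> {L..R}"
    using assms by (auto simp: not_less[symmetric])
qed simp

end

context FT_module
begin

lemma linear_mode_sum:
  assumes "\<And>j. j < L \<Longrightarrow> d j = 0"
  shows "Vector_Spaces.linear scale scale (mode_sum d)"
proof unfold_locales
  fix u v
  obtain A B where "\<forall>j>A. Phi j u = 0" "\<forall>j>B. Phi j v = 0"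
    using Phi_eventually_zero by meson
  then show "mode_sum d (u + v) = mode_sum d u + mode_sum d v"
    using assms
    by (simp add: mode_sum_window[of L d "max A B"] Phi_add scale_right_distrib sum.distrib)
next
  fix c v
  obtain A where "\<forall>j>A. Phi j v = 0" using Phi_eventually_zero by meson
  then show "mode_sum d (scale c v) = scale c (mode_sum d v)"
    using assms
    by (simp add: mode_sum_window[of L d A] Phi_scale scale_sum_right mult.commute)
qed

text \<open>By linearity the anticommutators with single modes add up, and \<open>d j * b j\<close>
  vanishes outside the range from \<open>L\<close> to \<open>R\<close>. Used with \<open>F\<close> a
  single mode and with \<open>F = dual\<close>.\<close>

lemma mode_sum_anticommutator:
  assumes d: "\<And>j. j < L \<Longrightarrow> d j = 0" and b: "\<And>j. j > R \<Longrightarrow> b j = 0"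
    and F: "Vector_Spaces.linear scale scale F"
    and anti: "\<And>j v. F (Phi j v) + Phi j (F v) = scale (b j) v"
  shows "F (mode_sum d v) + mode_sum d (F v) = scale (\<Sum>j\<in>{L..R}. d j * b j) v"
proof -
  interpret F: Vector_Spaces.linear scale scale F by (rule F)
  obtain A B where A: "\<forall>j>A. Phi j v = 0" and B: "\<forall>j>B. Phi j (F v) = 0"
    using Phi_eventually_zero by meson
  define Q where "Q = max R (max A B)"
  have v: "mode_sum d v = (\<Sum>j\<in>{L..Q}. scale (d j) (Phi j v))"
    using d A by (intro mode_sum_window) (auto simp: Q_def)
  have Fv: "mode_sum d (F v) = (\<Sum>j\<in>{L..Q}. scale (d j) (Phi j (F v)))"
    using d B by (intro mode_sum_window) (auto simp: Q_def)
  have "F (mode_sum d v) + mode_sum d (F v)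
      = (\<Sum>j\<in>{L..Q}. scale (d j) (F (Phi j v) + Phi j (F v)))"
    by (simp add: v Fv F.sum F.scale scale_right_distrib sum.distrib)
  also have "\<dots> = scale (\<Sum>j\<in>{L..Q}. d j * b j) v"
    by (simp add: anti scale_sum_left)
  also have "(\<Sum>j\<in>{L..Q}. d j * b j) = (\<Sum>j\<in>{L..R}. d j * b j)"
    by (rule sum.mono_neutral_right) (auto simp: Q_def b)
  finally show ?thesis .
qed

section \<open>Reflections and odd volume elements of the Clifford algebra\<close>

definition reflection :: "int \<Rightarrow> 'v \<Rightarrow> 'v" where
  "reflection m v = v + scale (2 * (-1) powi m) (Phi (- m) (Phi m v))"

lemma Phi_square: "m \<noteq> 0 \<Longrightarrow> Phi m (Phi m v) = 0"
proof -
  assume "m \<noteq> 0"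
  then have "scale 2 (Phi m (Phi m v)) = 0"
    using anticommutator[of m m v] scale_left_distrib[of 1 1 "Phi m (Phi m v)"] by simp
  then show ?thesis by simp
qed

text \<open>The reflection is \<open>1 - 2 P\<close>, where the projection \<open>P\<close> tests
  whether the mode \<open>Phi (- m)\<close> is occupied. \<open>Phi m\<close> and
  \<open>Phi (- m)\<close> change the occupation, hence the sign; all other modes commute with this
  even element.\<close>

lemma reflection_Phi:
  assumes "m > 0"
  shows "reflection m (Phi j v) = scale (if \<bar>j\<bar> = m then - 1 else 1) (Phi j (reflection m v))"
proof -
  have m: "m \<noteq> 0" "- m \<noteq> 0" using assms by auto
  have swap: "Phi a (Phi b w) = scale (if a + b = 0 then - ((-1) powi a) else 0) w - Phi b (Phi a w)"
    for a b w
    using anticommutator[of a b w] by (simp add: eq_diff_eq)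
  have lin: "Phi a (x - y) = Phi a x - Phi a y" for a x y
    using Phi_add[of a "x - y" y] by (simp add: eq_diff_eq)
  have sq: "(-1) powi m * (-1) powi m = (1 :: complex)"
    by (simp add: power_int_minus_left)
  have half: "x - scale 2 x = - x" for x
    using scale_left_distrib[of 1 1 x] by simp
  consider "j = m" | "j = - m" | "\<bar>j\<bar> \<noteq> m" by linarith
  then show ?thesis
  proof cases
    case 1
    have "Phi m (Phi (- m) (Phi m v)) = scale (- ((-1) powi m)) (Phi m v)"
      using swap[of m "- m" "Phi m v"] m by (simp add: Phi_square Phi_zero)
    then have "Phi m (reflection m v) = Phi m v - scale 2 (Phi m v)"
      by (simp add: reflection_def Phi_add Phi_scale sq)
    then show ?thesis
      using 1 m assms by (simp add: reflection_def Phi_square Phi_zero half)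
  next
    case 2
    have "(-1) powi - m = ((-1) powi m :: complex)" by (simp add: power_int_minus_left)
    then have "Phi (- m) (Phi m (Phi (- m) v)) = scale (- ((-1) powi m)) (Phi (- m) v)"
      using swap[of "- m" m "Phi (- m) v"] m by (simp add: Phi_square Phi_zero)
    then have "reflection m (Phi (- m) v) = Phi (- m) v - scale 2 (Phi (- m) v)"
      by (simp add: reflection_def sq)
    then show ?thesis
      using 2 m assms by (simp add: reflection_def Phi_square Phi_zero Phi_add Phi_scale half)
  next
    case 3
    then have "m + j \<noteq> 0" "- m + j \<noteq> 0" using assms by linarith+
    then have "Phi m (Phi j v) = - Phi j (Phi m v)"
      using swap[of m j v] by simp
    moreover have "Phi (- m) (Phi j w) = - Phi j (Phi (- m) w)" for w
      using \<open>- m + j \<noteq> 0\<close> swap[of "- m" j w] by simp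
    moreover have "Phi a (- x) = - Phi a x" for a x
      using lin[of a 0 x] by (simp add: Phi_zero)
    ultimately show ?thesis
      using 3 by (simp add: reflection_def Phi_add Phi_scale)
  qed
qed

primrec volume :: "nat \<Rightarrow> 'v \<Rightarrow> 'v" where
  "volume 0 v = Phi 0 v"
| "volume (Suc M) v = volume M (reflection (int (Suc M)) v)"

lemma volume_add: "volume M (u + v) = volume M u + volume M v"
proof (induction M arbitrary: u v)
  case (Suc M)
  have "reflection m (u + v) = reflection m u + reflection m v" for m
    by (simp add: reflection_def Phi_add scale_right_distrib)
  with Suc show ?case by simp
qed (simp add: Phi_add)

lemma volume_scale: "volume M (scale c v) = scale c (volume M v)"
proof (induction M arbitrary: v)
  case (Suc M)
  have "reflection m (scale c v) = scale c (reflection m v)" for m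
    by (simp add: reflection_def Phi_scale scale_right_distrib mult.commute)
  with Suc show ?case by simp
qed (simp add: Phi_scale)

text \<open>For \<open>0 < \<bar>j\<bar> \<le> M\<close> the sign from \<open>Phi 0\<close> cancels
  that from the reflection of index \<open>\<bar>j\<bar>\<close>; for
  \<open>\<bar>j\<bar> > M\<close> only the sign from \<open>Phi 0\<close> remains.\<close>

lemma volume_Phi:
  "volume M (Phi j v) = scale (if \<bar>j\<bar> \<le> int M then 1 else - 1) (Phi j (volume M v))"
proof (induction M arbitrary: v)
  case 0
  have "Phi 0 (Phi j v) = - Phi j (Phi 0 v)" if "j \<noteq> 0"
    using anticommutator[of 0 j v] that by (simp add: eq_neg_iff_add_eq_0)
  then show ?case by simp
next
  case (Suc M)
  show ?case
    by (auto simp: reflection_Phi volume_scale Suc.IH simp del: of_nat_Suc)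
qed

text \<open>Reflections fix \<open>vac\<close>, which leaves the eigenvalue of \<open>Phi 0\<close>.
  The property passes from \<open>u\<close> to \<open>Phi a u\<close> because
  \<open>volume M\<close> commutes with \<open>Phi a\<close> once
  \<open>M \<ge> \<bar>a\<bar>\<close>, and \<open>vac\<close> generates the module.\<close>

lemma volume_eventually:
  "\<exists>M0. \<forall>M\<ge>M0. volume M v = scale ((-1) ^ i * (1 / csqrt (-2))) v"
proof -
  let ?e = "(-1) ^ i * (1 / csqrt (-2))"
  let ?U = "{v. \<exists>M0. \<forall>M\<ge>M0. volume M v = scale ?e v}"
  have "invariant_subspace scale Phi ?U"
    unfolding invariant_subspace_def
  proof (intro conjI allI ballI)
    show "subspace ?U"
    proof (rule subspaceI)
      show "0 \<in> ?U" using volume_scale[of _ 0 0] by simp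
    next
      fix x y assume "x \<in> ?U" "y \<in> ?U"
      then obtain A B where "\<forall>M\<ge>A. volume M x = scale ?e x" "\<forall>M\<ge>B. volume M y = scale ?e y"
        by blast
      then have "\<forall>M\<ge>max A B. volume M (x + y) = scale ?e (x + y)"
        by (simp add: volume_add scale_right_distrib)
      then show "x + y \<in> ?U" by blast
    next
      fix c x assume "x \<in> ?U"
      then obtain A where "\<forall>M\<ge>A. volume M x = scale ?e x" by blast
      then have "\<forall>M\<ge>A. volume M (scale c x) = scale ?e (scale c x)"
        by (simp add: volume_scale mult.commute)
      then show "scale c x \<in> ?U" by blast
    qed
  next
    fix a u assume "u \<in> ?U"
    then obtain A where "\<forall>M\<ge>A. volume M u = scale ?e u" by blast
    then have "\<forall>M\<ge>max A (nat \<bar>a\<bar>). volume M (Phi a u) = scale ?e (Phi a u)"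
      by (auto simp: volume_Phi Phi_scale)
    then show "Phi a u \<in> ?U" by blast
  qed
  moreover have "vac \<in> ?U"
  proof -
    have "volume M vac = scale ?e vac" for M
    proof (induction M)
      case (Suc M)
      have "reflection (int (Suc M)) vac = vac"
        by (simp add: reflection_def annihilate Phi_zero)
      then show ?case using Suc by simp
    qed (simp add: zero_mode)
    then show ?thesis by blast
  qed
  ultimately show ?thesis using generated by blast
qed

text \<open>\<open>K\<close> commutes with the even reflections, so it anticommutes with
  \<open>volume M\<close>. For large \<open>M\<close> this acts on \<open>v\<close> and on
  \<open>K v\<close> as the same nonzero scalar \<open>e\<close>, so
  \<open>e K v = - e K v\<close>.\<close>

lemma anticommuting_operator_zero:
  assumes K: "Vector_Spaces.linear scale scale K"
    and anti: "\<And>j v. K (Phi j v) = - Phi j (K v)"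
  shows "K v = 0"
proof -
  interpret K: Vector_Spaces.linear scale scale K by (rule K)
  let ?e = "(-1) ^ i * (1 / csqrt (-2))"
  have Phi_neg: "Phi a (- x) = - Phi a x" for a x
    using Phi_scale[of a "- 1" x] by simp
  have "K (reflection m w) = reflection m (K w)" for m w
    by (simp add: reflection_def K.add K.scale anti Phi_neg)
  then have vol: "K (volume M w) = - volume M (K w)" for M w
    by (induction M arbitrary: w) (simp_all add: anti del: of_nat_Suc)
  obtain A B where "\<forall>M\<ge>A. volume M v = scale ?e v" "\<forall>M\<ge>B. volume M (K v) = scale ?e (K v)"
    using volume_eventually by meson
  then have "scale ?e (K v) = - scale ?e (K v)"
    using vol[of "max A B" v] by (simp add: K.scale)
  then have "scale (2 * ?e) (K v) = 0"
    using scale_left_distrib[of ?e ?e "K v"] by (simp add: eq_neg_iff_add_eq_0)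
  then show ?thesis by (simp add: scale_eq_0_iff)
qed

end

section \<open>Hyperplanes of modes\<close>

text \<open>All that the irreducibility argument needs to know about the coefficients of the odd
  generators. The last assumption at \<open>m = n\<close> forces \<open>g n n = 0\<close>, so the
  exception in \<open>leading\<close> really occurs.\<close>

locale triangular_modes = FT_module scale Phi vac i
  for scale :: "complex \<Rightarrow> 'v::ab_group_add \<Rightarrow> 'v" and Phi vac i +
  fixes g :: "int \<Rightarrow> int \<Rightarrow> complex" and lam :: "int \<Rightarrow> complex" and n :: int
  assumes lower: "j < m \<Longrightarrow> g m j = 0"
    and leading: "m \<noteq> n \<Longrightarrow> g m m \<noteq> 0"
    and lam_top: "lam n = 1"
    and lam_above: "j > n \<Longrightarrow> lam j = 0"
    and lam_annihilates: "(\<Sum>j\<in>{m..n}. g m j * lam j) = 0"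
begin

abbreviation A :: "int \<Rightarrow> 'v \<Rightarrow> 'v" where "A m \<equiv> mode_sum (g m)"

text \<open>The coefficients are chosen so that the anticommutator with \<open>Phi m\<close> is
  \<open>- lam m\<close>.\<close>

definition dual :: "'v \<Rightarrow> 'v" where
  "dual = mode_sum (\<lambda>j. (-1) powi j * lam (- j))"

text \<open>The value of the functional \<open>lam\<close> on the mode combination
  \<open>dual\<close>.\<close>

definition disc :: complex where
  "disc = (\<Sum>j\<in>{- n..n}. (-1) powi j * lam (- j) * lam j)"

lemma linear_A: "Vector_Spaces.linear scale scale (A m)"
  by (rule linear_mode_sum) (rule lower)

lemma linear_dual: "Vector_Spaces.linear scale scale dual"
  unfolding dual_def by (rule linear_mode_sum[of "- n"]) (simp add: lam_above)

lemma dual_Phi: "dual (Phi m v) + Phi m (dual v) = scale (- lam m) v"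
proof -
  let ?b = "\<lambda>j. if m + j = 0 then - ((-1) powi m) else 0 :: complex"
  have "Phi m (dual v) + dual (Phi m v)
      = scale (\<Sum>j\<in>{- n..\<bar>m\<bar>}. (-1) powi j * lam (- j) * ?b j) v"
    unfolding dual_def
    by (rule mode_sum_anticommutator) (auto simp: lam_above linear_Phi anticommutator)
  also have "(\<Sum>j\<in>{- n..\<bar>m\<bar>}. (-1) powi j * lam (- j) * ?b j)
      = (\<Sum>j\<in>{- n..\<bar>m\<bar>}. if j = - m then - lam m else 0)"
    by (intro sum.cong) (auto simp: add_eq_0_iff power_int_minus_left)
  \<comment> \<open>The index \<open>- m\<close> can miss the range only from below; then
    \<open>m > n\<close> and \<open>lam m = 0\<close>.\<close>
  also have "\<dots> = - lam m"
    by (auto simp: lam_above)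
  finally show ?thesis by (simp add: add.commute)
qed

lemma dual_A: "dual (A m v) = - A m (dual v)"
proof -
  have "dual (A m v) + A m (dual v) = scale (\<Sum>j\<in>{m..n}. g m j * - lam j) v"
    by (rule mode_sum_anticommutator[OF lower _ linear_dual]) (simp_all add: lam_above dual_Phi)
  also have "\<dots> = 0" using lam_annihilates[of m] by (simp add: sum_negf)
  finally show ?thesis by (simp add: eq_neg_iff_add_eq_0)
qed

lemma dual_square: "dual (dual v) = scale (- disc / 2) v"
proof -
  have "dual (dual v) + dual (dual v)
      = scale (\<Sum>j\<in>{- n..n}. (-1) powi j * lam (- j) * - lam j) v"
    using mode_sum_anticommutator[of "- n" "\<lambda>j. (-1) powi j * lam (- j)" n "\<lambda>j. - lam j" dual v]
    by (simp add: lam_above dual_Phi linear_dual flip: dual_def)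
  also have "\<dots> = scale (- disc) v" by (simp add: disc_def sum_negf)
  finally have "scale 2 (dual (dual v)) = scale (- disc) v"
    using scale_left_distrib[of 1 1 "dual (dual v)"] by simp
  then have "scale (1 / 2) (scale 2 (dual (dual v))) = scale (1 / 2) (scale (- disc) v)"
    by (rule arg_cong)
  then show ?thesis by simp
qed

text \<open>
  Modulo \<open>U\<close>, every \<open>x m\<close> is \<open>lam m\<close> times \<open>x n\<close>; this is used both for \<open>x m = Phi m v\<close> and
  for \<open>x m\<close> an anticommutator with \<open>Phi m\<close> applied to \<open>v\<close>.
\<close>

lemma modes_in_subspace:
  assumes U: "subspace U" and "disc \<noteq> 0"
    and above: "\<And>j. j > R \<Longrightarrow> x j = 0"
    and A: "\<And>m. (\<Sum>j\<in>{m..R}. scale (g m j) (x j)) \<in> U"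
    and dual: "(\<Sum>j\<in>{- n..R}. scale ((-1) powi j * lam (- j)) (x j)) \<in> U"
  shows "x m \<in> U"
proof -
  define y where "y j = x j - scale (lam j) (x n)" for j
  define Q where "Q = max R n"
  have restrict: "(\<Sum>j\<in>{a..Q}. scale (c j) (y j))
      = (\<Sum>j\<in>{a..R}. scale (c j) (x j)) - scale (\<Sum>j\<in>{a..n}. c j * lam j) (x n)" for a c
  proof -
    have "(\<Sum>j\<in>{a..Q}. scale (c j) (x j)) = (\<Sum>j\<in>{a..R}. scale (c j) (x j))"
      by (rule sum.mono_neutral_right) (auto simp: Q_def above)
    moreover have "(\<Sum>j\<in>{a..Q}. c j * lam j) = (\<Sum>j\<in>{a..n}. c j * lam j)"
      by (rule sum.mono_neutral_right) (auto simp: Q_def lam_above)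
    ultimately show ?thesis
      by (simp add: y_def scale_right_diff_distrib sum_subtractf flip: scale_sum_left)
  qed
  \<comment> \<open>Downward induction from \<open>Q\<close>, above which every \<open>y j\<close>
    vanishes. Row \<open>j\<close> of \<open>g\<close> yields \<open>y j\<close> from the higher
    ones; at \<open>j = n\<close>, where the leading coefficient fails, \<open>y n = 0\<close> by
    \<open>lam n = 1\<close>.\<close>
  have y: "y j \<in> U" if "Q - int k < j" for j k
    using that
  proof (induction k arbitrary: j)
    case 0
    then show ?case using subspace_0[OF U] by (simp add: y_def above lam_above Q_def)
  next
    case (Suc k)
    show ?case
    proof (cases "j = n \<or> Q - int k < j")
      case True
      then show ?thesis using Suc.IH subspace_0[OF U] by (auto simp: y_def lam_top)
    next
      case False
      then have j: "j \<noteq> n" "j = Q - int k" using Suc.prems by auto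
      have "(\<Sum>k\<in>{j..Q}. scale (g j k) (y k)) \<in> U"
        using A[of j] by (simp add: restrict lam_annihilates)
      moreover have "(\<Sum>k\<in>{j..Q}. scale (g j k) (y k))
          = scale (g j j) (y j) + (\<Sum>k\<in>{j + 1..Q}. scale (g j k) (y k))"
        using j by (subst simp_from_to) (auto simp: simp_from_to[symmetric])
      moreover have "(\<Sum>k\<in>{j + 1..Q}. scale (g j k) (y k)) \<in> U"
        using j by (intro subspace_sum[OF U] subspace_scale[OF U] Suc.IH) simp
      ultimately have "scale (g j j) (y j) \<in> U"
        using subspace_diff[OF U] by (metis add_diff_cancel_right')
      from subspace_scale[OF U this, of "1 / g j j"] show ?thesis
        using leading[OF j(1)] by simp
    qed
  qed
  have y: "y j \<in> U" for j
    using y[where k = "nat (Q - j + 1)"] by simp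
  \<comment> \<open>The coefficients of \<open>dual\<close> give \<open>disc\<close> times
    \<open>x n\<close> as the difference between their combinations of the \<open>x j\<close> and of
    the \<open>y j\<close>.\<close>
  have "(\<Sum>j\<in>{- n..Q}. scale ((-1) powi j * lam (- j)) (y j)) \<in> U"
    by (intro subspace_sum[OF U] subspace_scale[OF U] y)
  then have "scale disc (x n) \<in> U"
    using subspace_diff[OF U dual] unfolding restrict disc_def by fastforce
  from subspace_scale[OF U this, of "1 / disc"] have "x n \<in> U"
    using \<open>disc \<noteq> 0\<close> by simp
  then show ?thesis
    using subspace_add[OF U y subspace_scale[OF U, of "x n" "lam m"], of m] by (simp add: y_def)
qed

lemma invariant_Phi:
  assumes "invariant_subspace scale A U" "\<And>u. u \<in> U \<Longrightarrow> dual u \<in> U" "disc \<noteq> 0"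
  shows "invariant_subspace scale Phi U"
proof -
  have U: "subspace U" "\<And>m u. u \<in> U \<Longrightarrow> A m u \<in> U"
    using assms(1) by (auto simp: invariant_subspace_def)
  have "Phi m u \<in> U" if "u \<in> U" for m u
  proof -
    obtain R where R: "\<And>j. j > R \<Longrightarrow> Phi j u = 0" using Phi_eventually_zero by blast
    show ?thesis
    proof (rule modes_in_subspace[OF U(1) assms(3) R])
      show "(\<Sum>j\<in>{m..R}. scale (g m j) (Phi j u)) \<in> U" for m
        using U(2)[OF that, of m] by (simp add: mode_sum_window[of m _ R] lower R)
      show "(\<Sum>j\<in>{- n..R}. scale ((-1) powi j * lam (- j)) (Phi j u)) \<in> U"
        using assms(2)[OF that] by (simp add: dual_def mode_sum_window[of "- n" _ R] lam_above R)
    qed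
  qed
  then show ?thesis using U(1) by (simp add: invariant_subspace_def)
qed

text \<open>\<open>modes_in_subspace\<close> with the zero subspace, applied to the anticommutators
  of \<open>K\<close> with \<open>Phi j\<close> at \<open>v\<close>: every row of \<open>g\<close>
  and the coefficients of \<open>dual\<close> annihilate them.\<close>

lemma anticommuting_A_Phi:
  assumes K: "Vector_Spaces.linear scale scale K" and "disc \<noteq> 0"
    and A: "\<And>m v. K (A m v) = - A m (K v)" and dual: "\<And>v. K (dual v) = - dual (K v)"
  shows "K (Phi m v) = - Phi m (K v)"
proof -
  interpret K: Vector_Spaces.linear scale scale K by (rule K)
  obtain R1 R2 where R1: "\<forall>j>R1. Phi j v = 0" and R2: "\<forall>j>R2. Phi j (K v) = 0"
    using Phi_eventually_zero by meson
  define R where "R = max R1 R2"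
  have win: "K (mode_sum d v) + mode_sum d (K v)
      = (\<Sum>j\<in>{L..R}. scale (d j) (K (Phi j v) + Phi j (K v)))"
    if "\<And>j. j < L \<Longrightarrow> d j = 0" for d L
    using that R1 R2 mode_sum_window[of L d R v] mode_sum_window[of L d R "K v"]
    by (simp add: R_def K.sum K.scale scale_right_distrib sum.distrib)
  have "K (Phi m v) + Phi m (K v) \<in> {0}"
  proof (rule modes_in_subspace[OF subspace_single_0 assms(2), of R])
    show "K (Phi j v) + Phi j (K v) = 0" if "j > R" for j
      using that R1 R2 by (simp add: R_def K.zero)
    show "(\<Sum>j\<in>{m..R}. scale (g m j) (K (Phi j v) + Phi j (K v))) \<in> {0}" for m
      using win[of m "g m"] A[of m v] by (simp add: lower)
    show "(\<Sum>j\<in>{- n..R}. scale ((-1) powi j * lam (- j)) (K (Phi j v) + Phi j (K v))) \<in> {0}"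
      using win[of "- n" "\<lambda>j. (-1) powi j * lam (- j)"] dual[of v]
      by (simp add: lam_above flip: dual_def)
  qed
  then show ?thesis by (simp add: eq_neg_iff_add_eq_0)
qed

section \<open>The irreducibility criterion \<open>disc \<noteq> 0\<close>\<close>

lemma reducible_if_disc_zero:
  assumes "disc = 0"
  shows "\<not> irreducible_action scale A"
proof
  assume irr: "irreducible_action scale A"
  interpret D: Vector_Spaces.linear scale scale dual by (rule linear_dual)
  let ?U = "{v. dual v = 0}"
  have "A m u \<in> ?U" if "u \<in> ?U" for m u
  proof -
    interpret L: Vector_Spaces.linear scale scale "A m" by (rule linear_A)
    show ?thesis using that by (simp add: dual_A L.zero)
  qed
  then have "invariant_subspace scale A ?U"
    using D.subspace_kernel by (simp add: invariant_subspace_def)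
  then consider "?U = {0}" | "?U = UNIV" using irr by (auto simp: irreducible_action_def)
  \<comment> \<open>If the kernel is trivial, \<open>dual\<close> still vanishes, since its square
    is zero and so its image lies in the kernel. This contradicts its anticommutator
    \<open>- 1\<close> with \<open>Phi n\<close>.\<close>
  then have "dual v = 0" for v
  proof cases
    case 1
    moreover have "dual v \<in> ?U" using dual_square[of v] assms by simp
    ultimately show ?thesis by blast
  qed blast
  then have "scale (- lam n) vac = 0"
    using dual_Phi[of n vac] by (simp add: Phi_zero)
  then show False using vac_nonzero by (simp add: lam_top)
qed

lemma dual_invariant_subspace:
  assumes "disc \<noteq> 0" "subspace U" "U \<noteq> {0}" "\<And>m u. u \<in> U \<Longrightarrow> A m u \<in> U"
    "\<And>u. u \<in> U \<Longrightarrow> dual u \<in> U"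
  shows "U = UNIV"
  using invariant_Phi[of U] assms irreducible
  by (auto simp: irreducible_action_def invariant_subspace_def)

lemma irreducible_if_disc_nonzero:
  assumes disc: "disc \<noteq> 0"
  shows "irreducible_action scale A"
  unfolding irreducible_action_def
proof (intro allI impI disjCI)
  fix U assume "invariant_subspace scale A U" and "U \<noteq> UNIV"
  then have U: "subspace U" "\<And>m u. u \<in> U \<Longrightarrow> A m u \<in> U"
    by (auto simp: invariant_subspace_def)
  interpret D: Vector_Spaces.linear scale scale dual by (rule linear_dual)
  have A_add: "A m (u + v) = A m u + A m v" and A_scale: "A m (scale c u) = scale c (A m u)" for m u v c
  proof -
    interpret L: Vector_Spaces.linear scale scale "A m" by (rule linear_A)
    show "A m (u + v) = A m u + A m v" "A m (scale c u) = scale c (A m u)"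
      by (simp_all add: L.add L.scale)
  qed
  have A_neg: "A m (- u) = - A m u" for m u
    using A_scale[of m "- 1" u] by simp
  define c where "c = - disc / 2"
  have "c \<noteq> 0" using disc by (simp add: c_def)
  have sq: "dual (dual v) = scale c v" for v
    by (simp add: dual_square c_def)
  \<comment> \<open>The largest \<open>dual\<close>-stable subspace of \<open>U\<close>, as the
    square of \<open>dual\<close> is a scalar.\<close>
  let ?I = "{u \<in> U. dual u \<in> U}"
  have "?I = {0}"
  proof (rule ccontr)
    assume "?I \<noteq> {0}"
    moreover have "subspace ?I"
      using U(1) by (auto simp: subspace_def D.add D.scale D.zero)
    moreover have "A m u \<in> ?I" if "u \<in> ?I" for m u
      using that U by (auto simp: dual_A subspace_neg)
    moreover have "dual u \<in> ?I" if "u \<in> ?I" for u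
      using that U(1) by (auto simp: sq subspace_scale)
    ultimately have "?I = UNIV" using disc by (intro dual_invariant_subspace)
    then show False using \<open>U \<noteq> UNIV\<close> by auto
  qed
  show "U = {0}"
  proof (rule ccontr)
    assume "U \<noteq> {0}"
    \<comment> \<open>The smallest \<open>dual\<close>-stable subspace containing
      \<open>U\<close>.\<close>
    let ?S = "{a + dual b | a b. a \<in> U \<and> b \<in> U}"
    have "?S = UNIV"
    proof (rule dual_invariant_subspace[OF disc])
      show "subspace ?S"
      proof (rule subspaceI)
        show "0 \<in> ?S" using subspace_0[OF U(1)] D.zero by force
        fix x y assume "x \<in> ?S" "y \<in> ?S"
        then obtain a b a' b' where "x = a + dual b" "y = a' + dual b'"
          "a \<in> U" "b \<in> U" "a' \<in> U" "b' \<in> U" by blast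
        then have "x + y = (a + a') + dual (b + b')" "a + a' \<in> U" "b + b' \<in> U"
          using U(1) by (auto simp: D.add subspace_add)
        then show "x + y \<in> ?S" by blast
      next
        fix k x assume "x \<in> ?S"
        then obtain a b where "x = a + dual b" "a \<in> U" "b \<in> U" by blast
        then have "scale k x = scale k a + dual (scale k b)" "scale k a \<in> U" "scale k b \<in> U"
          using U(1) by (auto simp: D.scale scale_right_distrib subspace_scale)
        then show "scale k x \<in> ?S" by blast
      qed
      have "U \<subseteq> ?S" using subspace_0[OF U(1)] D.zero by force
      then show "?S \<noteq> {0}" using \<open>U \<noteq> {0}\<close> subspace_0[OF U(1)] by blast
    next
      fix m x assume "x \<in> ?S"
      then obtain a b where "x = a + dual b" "a \<in> U" "b \<in> U" by blast
      then have "A m x = A m a + dual (- A m b)" "A m a \<in> U" "- A m b \<in> U"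
        using U by (auto simp: A_add dual_A D.neg subspace_neg)
      then show "A m x \<in> ?S" by blast
    next
      fix x assume "x \<in> ?S"
      then obtain a b where "x = a + dual b" "a \<in> U" "b \<in> U" by blast
      then have "dual x = scale c b + dual a" "scale c b \<in> U" "a \<in> U"
        using U by (auto simp: D.add sq subspace_scale)
      then show "dual x \<in> ?S" by blast
    qed
    then have "\<forall>v. \<exists>a b. v = a + dual b \<and> a \<in> U \<and> b \<in> U" by blast
    then obtain p q where pq: "\<And>v. v = p v + dual (q v)" "\<And>v. p v \<in> U" "\<And>v. q v \<in> U" by metis
    have unique: "p v = a \<and> q v = b" if "v = a + dual b" "a \<in> U" "b \<in> U" for v a b
    proof -
      have "dual (q v - b) = a - p v"
        using pq(1)[of v] that(1) by (simp add: D.diff algebra_simps)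
      then have "q v - b \<in> ?I" using pq that U(1) by (simp add: subspace_diff)
      then have "q v = b" using \<open>?I = {0}\<close> by auto
      then show ?thesis using pq(1)[of v] that(1) by simp
    qed
    \<comment> \<open>\<open>K\<close> is \<open>dual\<close> composed with the operator that is 1
      on \<open>U\<close> and -1 on \<open>dual U\<close>. This sign operator commutes with each
      \<open>A m\<close>, which preserves both summands, and anticommutes with \<open>dual\<close>,
      which swaps them; hence \<open>K\<close> anticommutes with all of these.\<close>
    define K where "K v = dual (p v) - scale c (q v)" for v
    have K: "K (a + dual b) = dual a - scale c b" if "a \<in> U" "b \<in> U" for a b
      using unique[OF refl that] by (simp add: K_def)
    have "Vector_Spaces.linear scale scale K"
    proof unfold_locales
      fix u v
      have "u + v = (p u + p v) + dual (q u + q v)"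
        by (subst pq(1)[of u], subst pq(1)[of v]) (simp add: D.add algebra_simps)
      then show "K (u + v) = K u + K v"
        using K[of "p u + p v" "q u + q v"] pq U(1)
        by (simp add: K_def subspace_add D.add scale_right_distrib)
    next
      fix k v
      have "scale k v = scale k (p v) + dual (scale k (q v))"
        using pq(1)[of v] by (metis D.scale scale_right_distrib)
      then show "K (scale k v) = scale k (K v)"
        using K[of "scale k (p v)" "scale k (q v)"] pq U(1)
        by (simp add: K_def subspace_scale D.scale scale_right_diff_distrib mult.commute)
    qed
    moreover have K_A: "K (A m v) = - A m (K v)" for m v
    proof -
      have "A m v = A m (p v) + dual (- A m (q v))"
        by (subst pq(1)[of v]) (simp add: A_add dual_A D.neg)
      then have "K (A m v) = dual (A m (p v)) - scale c (- A m (q v))"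
        using K pq U by (simp add: subspace_neg)
      also have "\<dots> = - A m (dual (p v) + scale (- c) (q v))"
        by (simp only: dual_A A_add A_scale) simp
      finally show ?thesis by (simp add: K_def)
    qed
    moreover have K_dual: "K (dual v) = - dual (K v)" for v
    proof -
      have "dual v = scale c (q v) + dual (p v)"
        by (subst pq(1)[of v]) (simp add: D.add sq)
      then have "K (dual v) = dual (scale c (q v)) - scale c (p v)"
        using K pq U by (simp add: subspace_scale)
      then show ?thesis by (simp add: K_def D.diff sq)
    qed
    \<comment> \<open>On \<open>U\<close> the operator \<open>K\<close> is \<open>dual\<close>,
      which is injective because its square is the nonzero scalar \<open>c\<close>.\<close>
    ultimately have "K v = 0" for v
      using anticommuting_operator_zero[of K] anticommuting_A_Phi[OF _ disc] by blast
    moreover obtain u where "u \<in> U" "u \<noteq> 0" using \<open>U \<noteq> {0}\<close> subspace_0[OF U(1)] by blast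
    moreover have "K (u + dual 0) = dual u" using \<open>u \<in> U\<close> K[of u 0] subspace_0[OF U(1)] by simp
    ultimately have "dual (dual u) = 0" by (simp add: D.zero)
    then show False using \<open>u \<noteq> 0\<close> \<open>c \<noteq> 0\<close> by (simp add: sq)
  qed
qed

theorem irreducible_iff: "irreducible_action scale A \<longleftrightarrow> disc \<noteq> 0"
  using reducible_if_disc_zero irreducible_if_disc_nonzero by blast

end

section \<open>The action of the twisted superalgebra\<close>

lemma (in FT_module) FT_action_G_eq_mode_sum:
  "FT_action scale Phi \<chi> (G m) v = mode_sum (G_coeff \<chi> m) v"
proof -
  obtain K where K: "\<And>k. k > K \<Longrightarrow> half_mode \<chi> k = 0" using half_mode_bounded by blast
  obtain R where R: "\<And>j. j > R \<Longrightarrow> Phi j v = 0" using Phi_eventually_zero by blast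
  let ?L = "min m (m - K)" and ?R = "max R m"
  have "mode_sum (G_coeff \<chi> m) v = (\<Sum>j\<in>{?L..?R}. scale (G_coeff \<chi> m j) (Phi j v))"
    by (rule mode_sum_window) (auto simp: G_coeff_def K R)
  moreover have "FT_action scale Phi \<chi> (G m) v
      = (\<Sum>j\<in>{?L..?R}. scale (G_coeff \<chi> m j) (Phi j v))"
    by (rule G_action_window[OF K]) (auto simp: R)
  ultimately show ?thesis by simp
qed

text \<open>The even basis elements act by scalars, so they preserve every subspace.\<close>

lemma (in FT_module) irreducible_FT_action_iff:
  "irreducible_action scale (FT_action scale Phi \<chi>)
    \<longleftrightarrow> irreducible_action scale (\<lambda>m. mode_sum (G_coeff \<chi> m))"
proof -
  have "invariant_subspace scale (FT_action scale Phi \<chi>) U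
    \<longleftrightarrow> invariant_subspace scale (\<lambda>m. mode_sum (G_coeff \<chi> m)) U" for U
  proof -
    have "FT_action scale Phi \<chi> x u \<in> U"
      if "subspace U" "\<forall>m. \<forall>u\<in>U. mode_sum (G_coeff \<chi> m) u \<in> U" "u \<in> U" for x u
    proof (cases x)
      case (G m)
      then show ?thesis using that by (simp only: FT_action_G_eq_mode_sum)
    qed (use that in \<open>simp_all add: subspace_scale subspace_neg\<close>)
    then show ?thesis
      unfolding invariant_subspace_def FT_action_G_eq_mode_sum[symmetric] by blast
  qed
  then show ?thesis by (simp add: irreducible_action_def)
qed

theorem theorem5p1:
  fixes scale :: "complex \<Rightarrow> 'v::ab_group_add \<Rightarrow> 'v"
    and Phi :: "int \<Rightarrow> 'v \<Rightarrow> 'v" and vac :: 'v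
    and i N :: nat and l :: real and \<chi> :: "complex fls"
  assumes "2 * l = real N"
    and "i \<in> {1, 2}"
    and "FT_module scale Phi vac i"
    and "\<And>m. m > 0 \<Longrightarrow> half_mode \<chi> m = 0"
    and "half_mode \<chi> 0 = of_real l + 1/2"
  shows "irreducible_action scale (FT_action scale Phi \<chi>) \<longleftrightarrow>
           schur N (\<lambda>n. - 2 * int_mode (integral_part \<chi>) (- int n)) \<noteq> 0"
proof -
  interpret FT_module scale Phi vac i by (rule assms(3))
  define x where "x k = - 2 * half_mode \<chi> (- int k)" for k
  \<comment> \<open>The functional with value \<open>S_k\<close> on \<open>Phi (N - k)\<close>; its
    arguments \<open>x\<close> are all modes, integral or not, in doubled indices.\<close>
  define lam where "lam j = (if j \<le> int N then schur (nat (int N - j)) x else 0)" for j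
  have l: "l = real N / 2" using assms(1) by simp
  then have zero: "half_mode \<chi> 0 = of_nat N / 2 + 1 / 2" by (simp add: assms(5) l)
  interpret triangular_modes scale Phi vac i "G_coeff \<chi>" lam "int N"
  proof
    show "G_coeff \<chi> m j = 0" if "j < m" for j m
      using that by (simp add: G_coeff_def assms(4))
    \<comment> \<open>The leading coefficient is \<open>(N - m) / 2\<close>.\<close>
    show "G_coeff \<chi> m m \<noteq> 0" if "m \<noteq> int N" for m
    proof
      assume "G_coeff \<chi> m m = 0"
      then have "of_int m = (of_int (int N) :: complex)" by (simp add: G_coeff_def zero)
      then show False using that by (simp only: of_int_eq_iff)
    qed
    show "lam (int N) = 1" by (simp add: lam_def schur_0)
    show "lam j = 0" if "j > int N" for j using that by (simp add: lam_def)
    \<comment> \<open>With \<open>r = N - m\<close> this is half the Schur recurrence: the leading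
      term is \<open>r / 2\<close> times \<open>S_r\<close>, the others are \<open>- x k / 2\<close>
      times \<open>S_(r-k)\<close>. For \<open>m > N\<close> the sum is empty.\<close>
    show "(\<Sum>j\<in>{m..int N}. G_coeff \<chi> m j * lam j) = 0" for m
    proof (cases "m \<le> int N")
      case True
      define r where "r = nat (int N - m)"
      have m: "m = int N - int r" using True by (simp add: r_def)
      have "(\<Sum>j\<in>{m..int N}. G_coeff \<chi> m j * lam j)
          = (\<Sum>k\<in>{0..r}. G_coeff \<chi> m (m + int k) * schur (r - k) x)"
        by (rule sum.reindex_bij_witness[of _ "\<lambda>k. m + int k" "\<lambda>j. nat (j - m)"])
          (auto simp: m lam_def nat_diff_distrib' intro!: arg_cong[of _ _ "\<lambda>k. schur k x"])
      also have "\<dots> = G_coeff \<chi> m m * schur r x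
          + (\<Sum>k\<in>{1..r}. G_coeff \<chi> m (m + int k) * schur (r - k) x)"
        by (simp add: sum.atLeast_Suc_atMost)
      also have "(\<Sum>k\<in>{1..r}. G_coeff \<chi> m (m + int k) * schur (r - k) x)
          = (\<Sum>k\<in>{1..r}. (- 1 / 2) * (x k * schur (r - k) x))"
        by (intro sum.cong refl) (simp add: G_coeff_def x_def)
      also have "\<dots> = (- 1 / 2) * (of_nat r * schur r x)"
        unfolding schur_recurrence by (simp only: sum_distrib_left)
      also have "G_coeff \<chi> m m = of_nat r / 2"
        by (simp add: G_coeff_def zero m field_simps)
      finally show ?thesis by simp
    qed simp
  qed
  \<comment> \<open>Put \<open>j = k - N\<close>: then \<open>lam (- j)\<close> is
    \<open>S_k\<close> and \<open>lam j\<close> is \<open>S_(2N-k)\<close>.\<close>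
  have "disc = (\<Sum>k\<in>{0..2 * N}. (-1) ^ N * ((-1) ^ k * schur k x * schur (2 * N - k) x))"
    unfolding disc_def
    by (rule sum.reindex_bij_witness[of _ "\<lambda>k. int k - int N" "\<lambda>j. nat (j + int N)"])
      (auto simp: lam_def power_int_diff power_int_minus_left minus_one_power_iff even_nat_iff
        nat_diff_distrib' intro!: arg_cong2[of _ _ _ _ "\<lambda>a b. schur a x * schur b x"])
  also have "\<dots> = (-1) ^ N * schur N (\<lambda>k. x (2 * k))"
    unfolding schur_even_arguments by (simp only: sum_distrib_left)
  also have "(\<lambda>k. x (2 * k)) = (\<lambda>n. - 2 * int_mode (integral_part \<chi>) (- int n))"
    by (simp add: x_def int_mode_integral_part)
  finally show ?thesis
    unfolding irreducible_FT_action_iff irreducible_iff by simp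
qed

end
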